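(* Let $X$ be a metrizable compact topological space and $\mu$ a finite Borel measure on $X$ such that $X$ has a basis of open sets with $\mu$-null frontier. Then the topology $\tau_{ac}$ on $\mathcal{H}_{bac}(X,\mu)$ generated by the restriction to $\mathcal{H}_{bac}(X,\mu)$ of the compact-open topology on $\mathcal{H}(X)$ together with the topology induced by the (pseudo-)distance $\rho_{ac}(g,h):=\|\mathcal{D}(g)-\mathcal{D}(h)\|_{L^1(X,\mu)}$ is a completely metrizable group topology. If in addition $X$ is separable, then $\tau_{ac}$ is Polish.
   Context: $\mathcal{H}(X)$ is the group of homeomorphisms of $X$. For a Borel measure $\mu$ on $X$ and $g\in\mathcal{H}(X)$, $g_*\mu(A)=\mu(g^{-1}(A))$ and $g^*\mu:=(g^{-1})_*\mu$, i.e. $g^*\mu(A)=\mu(g(A))$. $\mathcal{H}_{bac}(X,\mu)$ is the subgroup of all $g\in\mathcal{H}(X)$ such that for every Borel set $A\subseteq X$ one has $\mu(A)=0$ if and only if $\mu(g(A))=0$. For $g\in\mathcal{H}_{bac}(X,\mu)$, $\mathcal{D}(g):=\frac{dg^*\mu}{d\mu}\in L^1(X,\mu)$ is the Radon–Nikodym derivative, so $\mu(g(A))=\int_A\mathcal{D}(g)\,d\mu$ for all Borel $A$. A group topology is a topology for which multiplication and inversion are continuous. The frontier of a set is its topological boundary. *)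

theory Defs
  imports "HOL-Analysis.Analysis" "HOL-Algebra.Bij"
begin

definition borel_of :: "'a topology \<Rightarrow> 'a measure" where
  "borel_of X = sigma (topspace X) {U. openin X U}"

text \<open>
  As in \<^const>\<open>BijGroup\<close>, self-maps of the carrier are taken extensional, so that two of
  them are equal if and only if they agree on the carrier.
\<close>

definition homeo :: "'a topology \<Rightarrow> ('a \<Rightarrow> 'a) set" where
  "homeo X = {g \<in> extensional (topspace X). homeomorphic_map X X g}"

definition homeo_bac :: "'a topology \<Rightarrow> 'a measure \<Rightarrow> ('a \<Rightarrow> 'a) set" where
  "homeo_bac X M =
     {g \<in> homeo X. \<forall>A\<in>sets M. emeasure M A = 0 \<longleftrightarrow> emeasure M (g ` A) = 0}"

definition homeo_bac_group :: "'a topology \<Rightarrow> 'a measure \<Rightarrow> ('a \<Rightarrow> 'a) monoid" where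
  "homeo_bac_group X M = (BijGroup (topspace X))\<lparr>carrier := homeo_bac X M\<rparr>"

text \<open>For a homeomorphism \<open>g\<close> this is the measure sending a Borel set \<open>A\<close> to the measure of \<open>g ` A\<close>.\<close>

definition pullback_measure :: "'a measure \<Rightarrow> ('a \<Rightarrow> 'a) \<Rightarrow> 'a measure" where
  "pullback_measure M g = distr M M (inv_into (space M) g)"

text \<open>
  The derivative \<^const>\<open>RN_deriv\<close> takes values in \<^typ>\<open>ennreal\<close>; for a finite measure it is
  finite almost everywhere, so \<^const>\<open>enn2real\<close> changes it on a null set only.
\<close>

definition homeo_deriv :: "'a measure \<Rightarrow> ('a \<Rightarrow> 'a) \<Rightarrow> 'a \<Rightarrow> real" where
  "homeo_deriv M g = (\<lambda>x. enn2real (RN_deriv M (pullback_measure M g) x))"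

definition rho_ac :: "'a measure \<Rightarrow> ('a \<Rightarrow> 'a) \<Rightarrow> ('a \<Rightarrow> 'a) \<Rightarrow> real" where
  "rho_ac M g h = (LINT x|M. \<bar>homeo_deriv M g x - homeo_deriv M h x\<bar>)"

definition compact_open_homeo :: "'a topology \<Rightarrow> ('a \<Rightarrow> 'a) topology" where
  "compact_open_homeo X =
     topology_generated_by {{g \<in> homeo X. g ` K \<subseteq> U} | K U. compactin X K \<and> openin X U}"

text \<open>\<^const>\<open>Metric_space.mtopology\<close> is not usable here, since distinct points may be at distance zero.\<close>

definition pseudometric_topology :: "'b set \<Rightarrow> ('b \<Rightarrow> 'b \<Rightarrow> real) \<Rightarrow> 'b topology" where
  "pseudometric_topology S d =
     topology_generated_by {{y \<in> S. d x y < r} | x r. x \<in> S \<and> r > 0}"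

definition tau_ac :: "'a topology \<Rightarrow> 'a measure \<Rightarrow> ('a \<Rightarrow> 'a) topology" where
  "tau_ac X M = topology_generated_by
     ({U. openin (subtopology (compact_open_homeo X) (homeo_bac X M)) U} \<union>
      {U. openin (pseudometric_topology (homeo_bac X M) (rho_ac M)) U})"

definition group_topology :: "('g, 'b) monoid_scheme \<Rightarrow> 'g topology \<Rightarrow> bool" where
  "group_topology G T \<longleftrightarrow>
     group G \<and> topspace T = carrier G \<and>
     continuous_map (prod_topology T T) T (\<lambda>(x, y). x \<otimes>\<^bsub>G\<^esub> y) \<and>
     continuous_map T T (\<lambda>x. inv\<^bsub>G\<^esub> x)"

definition polish_topology :: "'b topology \<Rightarrow> bool" where
  "polish_topology T \<longleftrightarrow> separable_space T \<and> completely_metrizable_space T"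

end

theory Submission
  imports Defs
begin

text \<open>
  Fix a metric \<open>d\<close> for the compact space. On the group of homeomorphisms that preserve the null sets,
  the topology \<^const>\<open>tau_ac\<close> is the topology of the metric
  \<open>sup\<^sub>x d(g x, h x) + \<parallel>D(g) - D(h)\<parallel>\<close>, since on homeomorphisms of a compact metric space the
  compact-open topology is that of uniform convergence (\<open>tau_ac_eq_mtopology\<close>).

  The group operations are governed by the action of the group on \<open>L\<^sup>1\<close> by
  \<open>transfer h f = D(h) (f \<circ> h)\<close>. It is isometric by the change of variables, and the chain rule reads
  \<open>D(g h) = transfer h (D(g))\<close>. Continuous functions are dense in \<open>L\<^sup>1\<close> of a finite Borel measure on a
  metrizable space (\<open>continuous_dense_L1\<close>), and this makes the action strongly continuous
  (\<open>transfer_strongly_continuous\<close>). Continuity of the product then follows from the chain rule, and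
  that of the inverse from \<open>transfer g (D(g\<^sup>-\<^sup>1)) = 1\<close> and isometry.

  A complete metric is obtained by adding the distance of the inverses. A Cauchy sequence converges,
  uniformly together with the inverses, to a homeomorphism \<open>g\<close>, while its derivatives converge in
  \<open>L\<^sup>1\<close> to some \<open>f\<close>, and those of the inverses to some \<open>f'\<close>. Integrals of continuous functions
  identify \<open>f\<close> as the density of the pullback of the measure under \<open>g\<close>, and likewise \<open>f'\<close> for the
  inverse (\<open>pullback_measure_limit\<close>); in particular \<open>g\<close> preserves null sets in both directions, and
  the sequence converges to \<open>g\<close>.

  Separability holds because a continuous map on a compact metric space is determined, up to a small
  error, by a modulus of continuity and by rounded values on a finite net. This applies to the
  homeomorphism and to a continuous function close to its derivative.
\<close>

section \<open>Continuous functions and finite Borel measures\<close>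

lemma space_borel_of [simp]: "space (borel_of X) = topspace X"
  unfolding borel_of_def by (rule space_measure_of) (auto dest: openin_subset)

lemma sets_borel_of: "sets (borel_of X) = sigma_sets (topspace X) {U. openin X U}"
  unfolding borel_of_def by (rule sets_measure_of) (auto dest: openin_subset)

lemma openin_sets_borel_of: "openin X U \<Longrightarrow> U \<in> sets (borel_of X)"
  by (simp add: sets_borel_of sigma_sets.Basic)

lemma sets_borel_of_closed: "sets (borel_of X) = sigma_sets (topspace X) {C. closedin X C}"
  unfolding sets_borel_of
proof (rule sigma_sets_eqI)
  fix U assume "U \<in> {U. openin X U}"
  then have "topspace X - (topspace X - U) = U" "closedin X (topspace X - U)"
    by (auto dest: openin_subset)
  then show "U \<in> sigma_sets (topspace X) {C. closedin X C}"
    by (metis mem_Collect_eq sigma_sets.Basic sigma_sets.Compl)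
next
  fix C assume "C \<in> {C. closedin X C}"
  then have "topspace X - (topspace X - C) = C" "openin X (topspace X - C)"
    by (auto dest: closedin_subset)
  then show "C \<in> sigma_sets (topspace X) {U. openin X U}"
    by (metis mem_Collect_eq sigma_sets.Basic sigma_sets.Compl)
qed

lemma closedin_sets_borel_of: "closedin X C \<Longrightarrow> C \<in> sets (borel_of X)"
  by (simp add: sets_borel_of_closed sigma_sets.Basic)

lemma continuous_map_measurable_borel_of:
  assumes "continuous_map X Y f"
  shows "f \<in> measurable (borel_of X) (borel_of Y)"
  unfolding borel_of_def[of Y]
proof (rule measurable_measure_of)
  show "{U. openin Y U} \<subseteq> Pow (topspace Y)" by (auto dest: openin_subset)
  show "f \<in> space (borel_of X) \<rightarrow> topspace Y" using assms by (auto simp: continuous_map_def)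
  fix U assume "U \<in> {U. openin Y U}"
  then have "openin X {x \<in> topspace X. f x \<in> U}" using assms by (auto simp: continuous_map_def)
  then show "f -` U \<inter> space (borel_of X) \<in> sets (borel_of X)"
    by (simp add: openin_sets_borel_of vimage_def Int_def conj_commute)
qed

lemma continuous_map_borel_measurable:
  fixes f :: "'a \<Rightarrow> real"
  assumes "continuous_map X euclidean f"
  shows "f \<in> borel_measurable (borel_of X)"
proof (rule borel_measurableI)
  fix U :: "real set" assume "open U"
  then have "openin X {x \<in> topspace X. f x \<in> U}"
    using assms by (auto simp: continuous_map_def)
  then show "f -` U \<inter> space (borel_of X) \<in> sets (borel_of X)"
    by (simp add: openin_sets_borel_of vimage_def Int_def conj_commute)
qed

text \<open>
  A closed set of a metrizable space is a decreasing intersection of open sets; a Urysohn function for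
  each of them is 1 on the closed set and, at a point outside, is eventually 0.
\<close>

lemma closed_indicator_limit_of_continuous:
  assumes X: "metrizable_space X" and C: "closedin X C"
  obtains f :: "nat \<Rightarrow> 'a \<Rightarrow> real"
  where "\<And>n. continuous_map X euclidean (f n)"
    "\<And>n x. x \<in> topspace X \<Longrightarrow> 0 \<le> f n x \<and> f n x \<le> 1"
    "\<And>x. x \<in> topspace X \<Longrightarrow> (\<lambda>n. f n x) \<longlonglongrightarrow> indicator C x"
proof -
  obtain U where U: "\<And>n. openin X (U n)" "\<And>n. U (Suc n) \<subseteq> U n" "\<Inter>(range U) = C"
    using closed_imp_gdelta_in[OF X C] unfolding gdelta_in_descending by blast
  have "\<exists>f :: 'a \<Rightarrow> real. continuous_map X (top_of_set {0..1}) f \<and>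
      f ` (topspace X - U n) \<subseteq> {0} \<and> f ` C \<subseteq> {1}" for n
    by (rule Urysohn_lemma[of X "topspace X - U n" C 0 1])
      (use U C X in \<open>auto simp: metrizable_imp_normal_space disjnt_def\<close>)
  then obtain f :: "nat \<Rightarrow> 'a \<Rightarrow> real" where f: "\<And>n. continuous_map X (top_of_set {0..1}) (f n)"
      "\<And>n. f n ` (topspace X - U n) \<subseteq> {0}" "\<And>n. f n ` C \<subseteq> {1}"
    by metis
  show thesis
  proof
    show "continuous_map X euclidean (f n)" for n
      using f(1) continuous_map_into_fulltopology by blast
    show "0 \<le> f n x \<and> f n x \<le> 1" if "x \<in> topspace X" for n x
      using f(1)[of n] that by (auto simp: continuous_map_in_subtopology)
    fix x assume x: "x \<in> topspace X"
    show "(\<lambda>n. f n x) \<longlonglongrightarrow> indicator C x"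
    proof (cases "x \<in> C")
      case True
      then have "f n x = 1" for n using f(3) by auto
      then show ?thesis using True by simp
    next
      case False
      then obtain n where "x \<notin> U n" using U(3) by auto
      moreover have "U m \<subseteq> U n" if "m \<ge> n" for m
        using that by (rule lift_Suc_antimono_le[rotated]) (rule U(2))
      ultimately have "f m x = 0" if "m \<ge> n" for m
        using f(2)[of m] x that by blast
      then have "(\<lambda>m. f m x) \<longlonglongrightarrow> 0"
        by (intro tendsto_eventually) (auto simp: eventually_sequentially)
      then show ?thesis using False by simp
    qed
  qed
qed

text \<open>
  The closed sets are a generator stable under intersection, and by dominated convergence their
  measures are limits of integrals of continuous functions.
\<close>

lemma finite_measure_eqI_continuous:
  assumes X: "metrizable_space X"
    and N: "finite_measure N" "sets N = sets (borel_of X)"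
    and N': "finite_measure N'" "sets N' = sets (borel_of X)"
    and eq: "\<And>f :: 'a \<Rightarrow> real. \<lbrakk>continuous_map X euclidean f;
        \<And>x. x \<in> topspace X \<Longrightarrow> 0 \<le> f x \<and> f x \<le> 1\<rbrakk> \<Longrightarrow> (LINT x|N. f x) = (LINT x|N'. f x)"
  shows "N = N'"
proof (rule measure_eqI_generator_eq[where \<Omega> = "topspace X" and E = "{C. closedin X C}"
      and A = "\<lambda>_. topspace X"])
  interpret N: finite_measure N by fact
  interpret N': finite_measure N' by fact
  have sp: "space N = topspace X" "space N' = topspace X"
    using N(2) N'(2) by (auto dest: sets_eq_imp_space_eq)
  show "Int_stable {C. closedin X C}" by (auto simp: Int_stable_def)
  show "{C. closedin X C} \<subseteq> Pow (topspace X)" by (auto dest: closedin_subset)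
  show "sets N = sigma_sets (topspace X) {C. closedin X C}"
    "sets N' = sigma_sets (topspace X) {C. closedin X C}"
    by (simp_all add: N N' sets_borel_of_closed)
  show "emeasure N (topspace X) \<noteq> \<infinity>" for i :: nat by simp
  fix C assume "C \<in> {C. closedin X C}"
  then have C: "closedin X C" by simp
  obtain f :: "nat \<Rightarrow> 'a \<Rightarrow> real" where f: "\<And>n. continuous_map X euclidean (f n)"
    "\<And>n x. x \<in> topspace X \<Longrightarrow> 0 \<le> f n x \<and> f n x \<le> 1"
    "\<And>x. x \<in> topspace X \<Longrightarrow> (\<lambda>n. f n x) \<longlonglongrightarrow> indicator C x"
    using closed_indicator_limit_of_continuous[OF X C] by blast
  have lim: "(\<lambda>n. LINT x|L. f n x) \<longlonglongrightarrow> measure L C"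
    if L: "finite_measure L" "sets L = sets (borel_of X)" for L
  proof -
    interpret L: finite_measure L by fact
    have [simp]: "space L = topspace X" using L(2) by (auto dest: sets_eq_imp_space_eq)
    have [measurable]: "C \<in> sets L" "\<And>n. f n \<in> borel_measurable L"
      using C f(1) continuous_map_borel_measurable[of X]
      by (auto simp: L(2) closedin_sets_borel_of cong: measurable_cong_sets)
    have "(\<lambda>n. LINT x|L. f n x) \<longlonglongrightarrow> (LINT x|L. indicator C x)"
      by (rule integral_dominated_convergence[where w = "\<lambda>_. 1"])
        (use f in \<open>auto intro!: AE_I2 simp: abs_le_iff\<close>, smt (verit))
    then show ?thesis by (simp add: Int_absorb2 closedin_subset[OF C])
  qed
  have "measure N C = measure N' C"
    using LIMSEQ_unique[OF lim[OF N]] lim[OF N'] eq[OF f(1,2)] by simp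
  then show "emeasure N C = emeasure N' C"
    by (simp add: N.emeasure_eq_measure N'.emeasure_eq_measure)
qed auto

text \<open>
  Membership in the \<open>L\<^sup>1\<close>-closure of the integrable continuous functions. Its closure properties
  (sums, multiples, dominated limits) match the cases of the induction rules for measurable sets and
  for integrable functions.
\<close>

definition L1_approx :: "'a topology \<Rightarrow> 'a measure \<Rightarrow> ('a \<Rightarrow> real) \<Rightarrow> bool" where
  "L1_approx X N f \<longleftrightarrow> integrable N f \<and>
     (\<forall>\<epsilon>>0. \<exists>\<phi>. continuous_map X euclidean \<phi> \<and> integrable N \<phi> \<and> (LINT x|N. \<bar>f x - \<phi> x\<bar>) < \<epsilon>)"

lemma L1_approx_add:
  assumes "L1_approx X N f" "L1_approx X N g"
  shows "L1_approx X N (\<lambda>x. f x + g x)"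
  unfolding L1_approx_def
proof (intro conjI allI impI)
  have fg: "integrable N f" "integrable N g" using assms by (auto simp: L1_approx_def)
  then show "integrable N (\<lambda>x. f x + g x)" by simp
  fix \<epsilon> :: real assume "\<epsilon> > 0"
  then obtain \<phi> \<psi> where \<phi>: "continuous_map X euclidean \<phi>" "integrable N \<phi>" "(LINT x|N. \<bar>f x - \<phi> x\<bar>) < \<epsilon>/2"
    and \<psi>: "continuous_map X euclidean \<psi>" "integrable N \<psi>" "(LINT x|N. \<bar>g x - \<psi> x\<bar>) < \<epsilon>/2"
    using assms unfolding L1_approx_def by (meson half_gt_zero)
  have "(LINT x|N. \<bar>f x + g x - (\<phi> x + \<psi> x)\<bar>) \<le> (LINT x|N. \<bar>f x - \<phi> x\<bar> + \<bar>g x - \<psi> x\<bar>)"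
    by (rule integral_mono) (use fg \<phi> \<psi> in auto)
  also have "\<dots> < \<epsilon>" using fg \<phi> \<psi> by simp
  finally show "\<exists>\<phi>. continuous_map X euclidean \<phi> \<and> integrable N \<phi> \<and> (LINT x|N. \<bar>f x + g x - \<phi> x\<bar>) < \<epsilon>"
    using \<phi> \<psi> by (intro exI[of _ "\<lambda>x. \<phi> x + \<psi> x"]) (auto intro: continuous_map_add)
qed

lemma L1_approx_cmult:
  assumes "L1_approx X N f"
  shows "L1_approx X N (\<lambda>x. c * f x)"
  unfolding L1_approx_def
proof (intro conjI allI impI)
  have f: "integrable N f" using assms by (auto simp: L1_approx_def)
  then show "integrable N (\<lambda>x. c * f x)" by simp
  fix \<epsilon> :: real assume "\<epsilon> > 0"
  then have "\<epsilon> / (\<bar>c\<bar> + 1) > 0" by simp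
  then obtain \<phi> where \<phi>: "continuous_map X euclidean \<phi>" "integrable N \<phi>" "(LINT x|N. \<bar>f x - \<phi> x\<bar>) < \<epsilon> / (\<bar>c\<bar> + 1)"
    using assms unfolding L1_approx_def by meson
  have "(LINT x|N. \<bar>c * f x - c * \<phi> x\<bar>) = \<bar>c\<bar> * (LINT x|N. \<bar>f x - \<phi> x\<bar>)"
    by (simp add: abs_mult flip: right_diff_distrib)
  also have "\<dots> \<le> (\<bar>c\<bar> + 1) * (LINT x|N. \<bar>f x - \<phi> x\<bar>)"
    by (intro mult_right_mono) auto
  also have "\<dots> < \<epsilon>" using \<phi>(3) by (simp add: pos_less_divide_eq mult.commute)
  finally show "\<exists>\<phi>. continuous_map X euclidean \<phi> \<and> integrable N \<phi> \<and> (LINT x|N. \<bar>c * f x - \<phi> x\<bar>) < \<epsilon>"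
    using \<phi> by (intro exI[of _ "\<lambda>x. c * \<phi> x"]) (auto intro: continuous_map_real_mult_left)
qed

lemma L1_approx_lim:
  assumes s: "\<And>n. L1_approx X N (s n)" and f: "integrable N f" and w: "integrable N w"
    and lim: "\<And>x. x \<in> space N \<Longrightarrow> (\<lambda>n. s n x) \<longlonglongrightarrow> f x"
    and bound: "\<And>n x. x \<in> space N \<Longrightarrow> \<bar>s n x\<bar> \<le> w x"
  shows "L1_approx X N f"
  unfolding L1_approx_def
proof (intro conjI allI impI f)
  fix \<epsilon> :: real assume "\<epsilon> > 0"
  have si: "integrable N (s n)" for n using s[of n] by (auto simp: L1_approx_def)
  have "(\<lambda>n. LINT x|N. \<bar>f x - s n x\<bar>) \<longlonglongrightarrow> (LINT x|N. 0)"
  proof (rule integral_dominated_convergence[where w = "\<lambda>x. \<bar>f x\<bar> + w x"])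
    show "AE x in N. (\<lambda>n. \<bar>f x - s n x\<bar>) \<longlonglongrightarrow> 0"
    proof (rule AE_I2)
      fix x assume "x \<in> space N"
      then have "(\<lambda>n. \<bar>f x - s n x\<bar>) \<longlonglongrightarrow> \<bar>f x - f x\<bar>"
        by (intro tendsto_intros lim)
      then show "(\<lambda>n. \<bar>f x - s n x\<bar>) \<longlonglongrightarrow> 0" by simp
    qed
    show "AE x in N. norm \<bar>f x - s n x\<bar> \<le> \<bar>f x\<bar> + w x" for n
      using bound[of _ n] by (intro AE_I2) (smt (verit) real_norm_def)
  qed (use f w si in auto)
  then have "eventually (\<lambda>n. (LINT x|N. \<bar>f x - s n x\<bar>) < \<epsilon>/2) sequentially"
    using \<open>\<epsilon> > 0\<close> by (intro order_tendstoD(2)) auto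
  then obtain n where n: "(LINT x|N. \<bar>f x - s n x\<bar>) < \<epsilon>/2"
    by (auto simp: eventually_sequentially)
  obtain \<phi> where \<phi>: "continuous_map X euclidean \<phi>" "integrable N \<phi>" "(LINT x|N. \<bar>s n x - \<phi> x\<bar>) < \<epsilon>/2"
    using s[of n] \<open>\<epsilon> > 0\<close> unfolding L1_approx_def by (meson half_gt_zero)
  have "(LINT x|N. \<bar>f x - \<phi> x\<bar>) \<le> (LINT x|N. \<bar>f x - s n x\<bar> + \<bar>s n x - \<phi> x\<bar>)"
    by (rule integral_mono) (use f si \<phi> in auto)
  also have "\<dots> < \<epsilon>" using f si \<phi> n by simp
  finally show "\<exists>\<phi>. continuous_map X euclidean \<phi> \<and> integrable N \<phi> \<and> (LINT x|N. \<bar>f x - \<phi> x\<bar>) < \<epsilon>"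
    using \<phi> by auto
qed

lemma L1_approx_continuous:
  "\<lbrakk>continuous_map X euclidean \<phi>; integrable N \<phi>\<rbrakk> \<Longrightarrow> L1_approx X N \<phi>"
  unfolding L1_approx_def by (intro conjI allI impI exI[of _ \<phi>]) auto

text \<open>
  A Dynkin-system argument starting from the closed sets.
\<close>

lemma L1_approx_indicator:
  assumes X: "metrizable_space X" and N: "finite_measure N" "sets N = sets (borel_of X)"
    and A: "A \<in> sets N"
  shows "L1_approx X N (indicator A)"
proof -
  interpret finite_measure N by fact
  have sp: "space N = topspace X" using N(2) by (auto dest: sets_eq_imp_space_eq)
  have sets: "sets N = sigma_sets (topspace X) {C. closedin X C}"
    by (simp add: N sets_borel_of_closed)
  have "Int_stable {C. closedin X C}" "{C. closedin X C} \<subseteq> Pow (topspace X)"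
    by (auto simp: Int_stable_def dest: closedin_subset)
  then show ?thesis
    using A[unfolded sets]
  proof (induction rule: sigma_sets_induct_disjoint)
    case (basic C)
    then have C: "closedin X C" by simp
    obtain f :: "nat \<Rightarrow> 'a \<Rightarrow> real" where f: "\<And>n. continuous_map X euclidean (f n)"
      "\<And>n x. x \<in> topspace X \<Longrightarrow> 0 \<le> f n x \<and> f n x \<le> 1"
      "\<And>x. x \<in> topspace X \<Longrightarrow> (\<lambda>n. f n x) \<longlonglongrightarrow> indicator C x"
      using closed_indicator_limit_of_continuous[OF X C] by blast
    have [measurable]: "C \<in> sets N" "\<And>n. f n \<in> borel_measurable N"
      using C f(1) continuous_map_borel_measurable[of X]
      by (auto simp: N(2) closedin_sets_borel_of cong: measurable_cong_sets)
    have fi: "integrable N (f n)" for n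
      by (rule integrable_const_bound[where B = 1])
        (use f(2)[of _ n] sp in \<open>auto intro!: AE_I2 simp: abs_le_iff, smt (verit)\<close>)
    show ?case
    proof (rule L1_approx_lim[where s = f and w = "\<lambda>_. 1"])
      show "\<bar>f n x\<bar> \<le> 1" if "x \<in> space N" for n x
        using f(2)[of x n] that sp by auto
    qed (use f fi sp in \<open>auto intro: L1_approx_continuous simp: less_top[symmetric]\<close>)
  next
    case empty
    have "L1_approx X N (\<lambda>_. 0)" by (intro L1_approx_continuous) auto
    then show ?case by (simp add: indicator_def[abs_def])
  next
    case (compl A)
    have one: "L1_approx X N (\<lambda>_. 1)" by (intro L1_approx_continuous) auto
    have "L1_approx X N (\<lambda>x. 1 + (-1) * indicator A x)"
      by (intro L1_approx_add one L1_approx_cmult compl)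
    then show ?case
    proof (rule L1_approx_lim[where s = "\<lambda>_. _" and w = "\<lambda>_. 1"])
      have "topspace X - A \<in> sets N"
        unfolding sets using compl(1) by (rule sigma_sets.Compl)
      then show "integrable N (indicator (topspace X - A) :: _ \<Rightarrow> real)"
        by (simp add: less_top[symmetric])
    qed (auto simp: sp indicator_def)
  next
    case (union A)
    have A [measurable]: "A i \<in> sets N" for i using union(2) sets by auto
    have fin: "L1_approx X N (indicator (\<Union>i<n. A i))" for n
    proof (induction n)
      case 0
      have "L1_approx X N (\<lambda>_. 0)" by (intro L1_approx_continuous) auto
      then show ?case by (simp add: indicator_def[abs_def])
    next
      case (Suc n)
      have "A i \<inter> A n = {}" if "i < n" for i
        using that by (intro disjoint_family_onD[OF union(1)]) auto
      then have "(\<Union>i<n. A i) \<inter> A n = {}" by blast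
      then have "indicator (\<Union>i<Suc n. A i) x = (indicator (\<Union>i<n. A i) x + indicator (A n) x :: real)" for x
        unfolding lessThan_Suc UN_insert by (subst Un_commute) (rule indicator_add[symmetric])
      then have "indicator (\<Union>i<Suc n. A i) = (\<lambda>x. indicator (\<Union>i<n. A i) x + indicator (A n) x :: real)"
        by (rule ext)
      with L1_approx_add[OF Suc union(3)[of n]] show ?case by (simp only:)
    qed
    show ?case
    proof (rule L1_approx_lim[OF fin, where w = "\<lambda>_. 1"])
      show "(\<lambda>n. indicator (\<Union>i<n. A i) x :: real) \<longlonglongrightarrow> indicator (\<Union>i. A i) x" for x
        by (rule LIMSEQ_indicator_UN)
      have "(\<Union>i. A i) \<in> sets N" by measurable
      then show "integrable N (indicator (\<Union>i. A i) :: _ \<Rightarrow> real)"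
        by (simp add: less_top[symmetric])
    qed (auto simp: indicator_def)
  qed
qed

lemma continuous_dense_L1:
  fixes f :: "'a \<Rightarrow> real"
  assumes X: "metrizable_space X" and N: "finite_measure N" "sets N = sets (borel_of X)"
    and f: "integrable N f" and \<epsilon>: "\<epsilon> > 0"
  obtains \<phi> where "continuous_map X euclidean \<phi>" "integrable N \<phi>" "(LINT x|N. \<bar>f x - \<phi> x\<bar>) < \<epsilon>"
proof -
  from f have "L1_approx X N f"
  proof (induction rule: integrable_induct)
    case (base A c)
    then show ?case
      using L1_approx_cmult[OF L1_approx_indicator[OF X N], of A c] by (simp add: mult.commute)
  next
    case (add f g)
    then show ?case by (intro L1_approx_add)
  next
    case (lim f s)
    show ?case
      by (rule L1_approx_lim[of X N s f "\<lambda>x. 2 * \<bar>f x\<bar>"]) (use lim in auto)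
  qed
  then show thesis using \<epsilon> that unfolding L1_approx_def by blast
qed

section \<open>Completeness of the space of integrable functions\<close>

text \<open>
  A subsequence with geometrically decreasing gaps has, almost everywhere, absolutely summable
  increments, which gives a pointwise limit and an integrable majorant.
\<close>

lemma L1_complete:
  fixes f :: "nat \<Rightarrow> 'a \<Rightarrow> real"
  assumes f [measurable, simp]: "\<And>n. integrable N (f n)"
    and Cauchy: "\<And>\<epsilon>. \<epsilon> > 0 \<Longrightarrow> \<exists>K. \<forall>m\<ge>K. \<forall>n\<ge>K. (LINT x|N. \<bar>f m x - f n x\<bar>) < \<epsilon>"
  obtains g where "integrable N g" "(\<lambda>n. LINT x|N. \<bar>f n x - g x\<bar>) \<longlonglongrightarrow> 0"
proof -
  have "\<exists>r. \<forall>k. (r k < r (Suc k)) \<and> (\<forall>m\<ge>r k. \<forall>n\<ge>r k. (LINT x|N. \<bar>f m x - f n x\<bar>) < (1/2)^k)"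
  proof -
    have "\<forall>k. \<exists>K. \<forall>m\<ge>K. \<forall>n\<ge>K. (LINT x|N. \<bar>f m x - f n x\<bar>) < (1/2)^k"
      using Cauchy by simp
    then obtain K where K: "\<And>k m n. \<lbrakk>m \<ge> K k; n \<ge> K k\<rbrakk> \<Longrightarrow> (LINT x|N. \<bar>f m x - f n x\<bar>) < (1/2)^k"
      by metis
    \<comment> \<open>Partial sums of the thresholds dominate each of them; the summand \<open>k\<close> makes the indices strictly increasing.\<close>
  define r where "r k = (\<Sum>i\<le>k. K i) + k" for k
    have "K k \<le> r k" for k unfolding r_def by (simp add: trans_le_add1 member_le_sum)
    then have "\<forall>m\<ge>r k. \<forall>n\<ge>r k. (LINT x|N. \<bar>f m x - f n x\<bar>) < (1/2)^k" for k
      using K order_trans by blast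
    moreover have "r k < r (Suc k)" for k by (simp add: r_def)
    ultimately show ?thesis by blast
  qed
  then obtain r where r: "\<And>k. r k < r (Suc k)"
    and small: "\<And>k m n. \<lbrakk>m \<ge> r k; n \<ge> r k\<rbrakk> \<Longrightarrow> (LINT x|N. \<bar>f m x - f n x\<bar>) < (1/2)^k"
    by metis
  have mono: "r j \<le> r k" if "j \<le> k" for j k
    using that by (rule lift_Suc_mono_le[rotated]) (simp add: r less_imp_le)
  define h where "h k x = f (r (Suc k)) x - f (r k) x" for k x
  have h [measurable, simp]: "integrable N (h k)" for k by (simp add: h_def[abs_def])
  have hs: "(LINT x|N. \<bar>h k x\<bar>) \<le> (1/2)^k" for k
    unfolding h_def using small[of k "r (Suc k)" "r k"] mono[of k "Suc k"] by (simp add: less_imp_le)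
  have geo: "summable (\<lambda>k. (1/2::real)^k)" by (rule summable_geometric) simp
  have sumI: "summable (\<lambda>k. LINT x|N. \<bar>h k x\<bar>)"
    by (rule summable_comparison_test'[OF geo, of 0]) (use hs in auto)
  have AEs: "AE x in N. summable (\<lambda>k. \<bar>h k x\<bar>)"
  proof -
    have "(\<integral>\<^sup>+x. (\<Sum>k. ennreal \<bar>h k x\<bar>) \<partial>N) = (\<Sum>k. \<integral>\<^sup>+x. ennreal \<bar>h k x\<bar> \<partial>N)"
      by (rule nn_integral_suminf) measurable
    also have "\<dots> = (\<Sum>k. ennreal (LINT x|N. \<bar>h k x\<bar>))"
      by (intro suminf_cong nn_integral_eq_integral) auto
    also have "\<dots> = ennreal (\<Sum>k. LINT x|N. \<bar>h k x\<bar>)"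
      by (rule suminf_ennreal2) (use sumI in auto)
    finally have "(\<integral>\<^sup>+x. (\<Sum>k. ennreal \<bar>h k x\<bar>) \<partial>N) \<noteq> \<infinity>" by simp
    then have "AE x in N. (\<Sum>k. ennreal \<bar>h k x\<bar>) \<noteq> \<infinity>"
      by (intro nn_integral_PInf_AE) auto
    then show ?thesis
      by eventually_elim (auto intro: summable_suminf_not_top)
  qed
  \<comment> \<open>The majorant \<open>w\<close> of the whole subsequence allows dominated convergence to its limit \<open>g\<close>.\<close>
  define w where "w x = \<bar>f (r 0) x\<bar> + (\<Sum>k. \<bar>h k x\<bar>)" for x
  define g where "g x = f (r 0) x + (\<Sum>k. h k x)" for x
  have w: "integrable N w"
    unfolding w_def using integrable_suminf[of N "\<lambda>k x. \<bar>h k x\<bar>"] AEs sumI by auto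
  have g: "integrable N g"
    unfolding g_def using integrable_suminf[of N h] AEs sumI by auto
  have tel: "f (r k) x = f (r 0) x + (\<Sum>i<k. h i x)" for k x
    by (simp add: h_def sum_lessThan_telescope[of "\<lambda>k. f (r k) x"])
  have lim: "AE x in N. (\<lambda>k. f (r k) x) \<longlonglongrightarrow> g x"
    using AEs
  proof eventually_elim
    case (elim x)
    have "(\<lambda>k. f (r 0) x + (\<Sum>i<k. h i x)) \<longlonglongrightarrow> f (r 0) x + (\<Sum>k. h k x)"
      by (intro tendsto_intros summable_LIMSEQ summable_rabs_cancel[OF elim])
    then show ?case by (simp add: g_def flip: tel)
  qed
  have bound: "AE x in N. \<bar>f (r k) x\<bar> \<le> w x" for k
    using AEs
  proof eventually_elim
    case (elim x)
    have "\<bar>\<Sum>i<k. h i x\<bar> \<le> (\<Sum>i<k. \<bar>h i x\<bar>)" by (rule sum_abs)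
    also have "\<dots> \<le> (\<Sum>i. \<bar>h i x\<bar>)" using elim by (intro sum_le_suminf) auto
    finally show ?case unfolding w_def tel[of k] by linarith
  qed
  have conv: "(\<lambda>k. LINT x|N. \<bar>f n x - f (r k) x\<bar>) \<longlonglongrightarrow> (LINT x|N. \<bar>f n x - g x\<bar>)" for n
  proof (rule integral_dominated_convergence[where w = "\<lambda>x. \<bar>f n x\<bar> + w x"])
    show "AE x in N. (\<lambda>k. \<bar>f n x - f (r k) x\<bar>) \<longlonglongrightarrow> \<bar>f n x - g x\<bar>"
      using lim by eventually_elim (intro tendsto_intros)
    show "AE x in N. norm \<bar>f n x - f (r k) x\<bar> \<le> \<bar>f n x\<bar> + w x" for k
      using bound[of k] by eventually_elim auto
  qed (use w g in auto)
  have "(\<lambda>n. LINT x|N. \<bar>f n x - g x\<bar>) \<longlonglongrightarrow> 0"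
  proof (rule LIMSEQ_I)
    fix \<epsilon> :: real assume "\<epsilon> > 0"
    then obtain K where K: "\<And>m n. \<lbrakk>m \<ge> K; n \<ge> K\<rbrakk> \<Longrightarrow> (LINT x|N. \<bar>f m x - f n x\<bar>) < \<epsilon>/2"
      using Cauchy[of "\<epsilon>/2"] by auto
    have "(LINT x|N. \<bar>f n x - g x\<bar>) \<le> \<epsilon>/2" if "n \<ge> K" for n
    proof (rule LIMSEQ_le_const2[OF conv], intro exI[of _ K] allI impI)
      fix k assume "K \<le> k"
      moreover have "k \<le> r k" by (rule seq_suble) (simp add: strict_mono_Suc_iff r)
      ultimately show "(LINT x|N. \<bar>f n x - f (r k) x\<bar>) \<le> \<epsilon>/2"
        using K[of n "r k"] that by simp
    qed
    then show "\<exists>K. \<forall>n\<ge>K. norm ((LINT x|N. \<bar>f n x - g x\<bar>) - 0) < \<epsilon>"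
      using \<open>\<epsilon> > 0\<close> by (intro exI[of _ K]) (fastforce simp: abs_of_nonneg)
  qed
  with g that show thesis by blast
qed

section \<open>Maps on compact metric spaces\<close>

context Metric_space
begin

lemma compact_uniformly_continuous:
  assumes "compact_space mtopology" "Metric_space Y e"
    and "continuous_map mtopology (Metric_space.mtopology Y e) f" "\<epsilon> > 0"
  obtains \<delta> where "\<delta> > 0" "\<And>x y. \<lbrakk>x \<in> M; y \<in> M; d x y < \<delta>\<rbrakk> \<Longrightarrow> e (f x) (f y) < \<epsilon>"
proof -
  have "uniformly_continuous_map (metric (M, d)) (metric (Y, e)) f"
    using assms Metric_space_axioms
    by (intro continuous_imp_uniformly_continuous_map)
      (simp add: mtopology_of_def Metric_space.mspace_metric Metric_space.mdist_metric)
  then have "\<exists>\<delta>>0. \<forall>x\<in>M. \<forall>y\<in>M. d y x < \<delta> \<longrightarrow> e (f y) (f x) < \<epsilon>"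
    using assms Metric_space_axioms
    by (simp add: uniformly_continuous_map_def Metric_space.mspace_metric Metric_space.mdist_metric)
  then show thesis using that by blast
qed

lemma compact_uniformly_continuous_real:
  fixes f :: "'a \<Rightarrow> real"
  assumes "compact_space mtopology" "continuous_map mtopology euclidean f" "\<epsilon> > 0"
  obtains \<delta> where "\<delta> > 0" "\<And>x y. \<lbrakk>x \<in> M; y \<in> M; d x y < \<delta>\<rbrakk> \<Longrightarrow> \<bar>f x - f y\<bar> < \<epsilon>"
proof -
  have "continuous_map mtopology Met_TC.mtopology f" using assms(2) by simp
  from compact_uniformly_continuous[OF assms(1) Met_TC.Metric_space_axioms this assms(3)]
  show thesis using that unfolding dist_real_def by blast
qed

lemma compact_finite_net:
  assumes "compact_space mtopology" "\<epsilon> > 0"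
  obtains E where "finite E" "E \<subseteq> M" "\<And>x. x \<in> M \<Longrightarrow> \<exists>y\<in>E. d x y < \<epsilon>"
proof -
  have "mtotally_bounded M"
    using assms(1) by (simp add: compact_space_eq_mcomplete_mtotally_bounded)
  from this[unfolded mtotally_bounded_def, rule_format, OF assms(2)]
  obtain E where E: "finite E" "E \<subseteq> M" "M \<subseteq> (\<Union>x\<in>E. mball x \<epsilon>)" by (elim exE conjE)
  have "\<exists>y\<in>E. d x y < \<epsilon>" if x: "x \<in> M" for x
  proof -
    obtain y where "y \<in> E" "x \<in> mball y \<epsilon>" using E(3) x by blast
    then show ?thesis by (intro bexI[of _ y]) (simp_all add: commute)
  qed
  then show thesis by (rule that[OF E(1,2)])
qed

text \<open>
  One representative of each class, for each error \<open>1/(n+1)\<close>, gives a countable dense set. In this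
  form no countable dense subset needs to be exhibited in a space of functions: it is enough to code
  its elements, up to a small error, by countably many values.
\<close>

lemma separable_if_countably_many_small_classes:
  assumes "\<And>\<epsilon>. \<epsilon> > 0 \<Longrightarrow> \<exists>c :: 'a \<Rightarrow> 'c. countable (c ` M) \<and> (\<forall>x\<in>M. \<forall>y\<in>M. c x = c y \<longrightarrow> d x y < \<epsilon>)"
  shows "separable_space mtopology"
proof -
  have "\<forall>n. \<exists>c :: 'a \<Rightarrow> 'c. countable (c ` M) \<and>
      (\<forall>x\<in>M. \<forall>y\<in>M. c x = c y \<longrightarrow> d x y < 1 / Suc n)"
    by (intro allI assms) simp
  from choice[OF this] obtain c :: "nat \<Rightarrow> 'a \<Rightarrow> 'c" where
    "\<forall>n. countable (c n ` M) \<and> (\<forall>x\<in>M. \<forall>y\<in>M. c n x = c n y \<longrightarrow> d x y < 1 / Suc n)" ..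
  then have c: "countable (c n ` M)" "\<lbrakk>x \<in> M; y \<in> M; c n x = c n y\<rbrakk> \<Longrightarrow> d x y < 1 / Suc n" for n x y
    by (simp_all only: simp_thms)
  define C where "C = (\<Union>n. inv_into M (c n) ` (c n ` M))"
  have "C \<subseteq> M" unfolding C_def using inv_into_into[of _ _ M] by fastforce
  moreover have "countable C" unfolding C_def using c(1) by blast
  moreover have "mtopology closure_of C = M"
  proof (intro equalityI subsetI)
    fix x assume x: "x \<in> M"
    have "\<exists>y\<in>C. d x y < r" if "r > 0" for r
    proof -
      obtain n where n: "1 / real (Suc n) < r" using nat_approx_posE \<open>r > 0\<close> by blast
      let ?y = "inv_into M (c n) (c n x)"
      have "?y \<in> C" using x by (auto simp: C_def)
      moreover have "d x ?y < 1 / Suc n"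
        by (intro c(2) x) (use x in \<open>auto simp: f_inv_into_f inv_into_into\<close>)
      ultimately show ?thesis using n by (intro bexI[of _ ?y]) auto
    qed
    then show "x \<in> mtopology closure_of C"
      using x \<open>C \<subseteq> M\<close> unfolding metric_closure_of in_mball mem_Collect_eq by blast
  qed (auto simp: metric_closure_of)
  ultimately show ?thesis unfolding separable_space_def by auto
qed

text \<open>
  This is the separability of the space of continuous maps from a compact metric space to a separable
  one. It is used twice: for the homeomorphisms themselves and for the continuous real functions
  that approximate their derivatives.
\<close>

lemma continuous_maps_countably_many_small_classes:
  assumes cpt: "compact_space mtopology" and Y: "Metric_space Y e"
    and F: "countable F" "F \<subseteq> Y" "\<And>y. y \<in> Y \<Longrightarrow> \<exists>z\<in>F. e y z < \<epsilon>" and \<epsilon>: "\<epsilon> > 0"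
  obtains c :: "('a \<Rightarrow> 'b) \<Rightarrow> nat \<times> ('a \<Rightarrow> 'b)"
  where "countable (range c)"
    "\<And>f g x. \<lbrakk>continuous_map mtopology (Metric_space.mtopology Y e) f;
       continuous_map mtopology (Metric_space.mtopology Y e) g; c f = c g; x \<in> M\<rbrakk>
      \<Longrightarrow> e (f x) (g x) < 4 * \<epsilon>"
proof -
  interpret Y: Metric_space Y e by fact
  have "\<forall>m. \<exists>E. finite E \<and> E \<subseteq> M \<and> (\<forall>x\<in>M. \<exists>y\<in>E. d x y < 1 / Suc m)"
  proof
    fix m
    have "1 / real (Suc m) > 0" by simp
    from compact_finite_net[OF cpt this]
    show "\<exists>E. finite E \<and> E \<subseteq> M \<and> (\<forall>x\<in>M. \<exists>y\<in>E. d x y < 1 / Suc m)" by metis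
  qed
  from choice[OF this] obtain E where
    "\<forall>m. finite (E m) \<and> E m \<subseteq> M \<and> (\<forall>x\<in>M. \<exists>y\<in>E m. d x y < 1 / Suc m)" ..
  then have E: "finite (E m)" "E m \<subseteq> M" "x \<in> M \<Longrightarrow> \<exists>y\<in>E m. d x y < 1 / Suc m" for m x
    by (simp_all only: simp_thms)
  define tame where "tame f m \<longleftrightarrow> (\<forall>x\<in>M. \<forall>y\<in>M. d x y < 1 / Suc m \<longrightarrow> e (f x) (f y) < \<epsilon>)" for f m
  \<comment> \<open>The default value makes \<open>near\<close> range over a countable set also outside \<open>Y\<close>.\<close>
  define near where "near y = (if \<exists>z\<in>F. e y z < \<epsilon> then SOME z. z \<in> F \<and> e y z < \<epsilon> else undefined)" for y
  have ex: "(SOME z. z \<in> F \<and> e y z < \<epsilon>) \<in> F \<and> e y (SOME z. z \<in> F \<and> e y z < \<epsilon>) < \<epsilon>"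
    if "\<exists>z\<in>F. e y z < \<epsilon>" for y
    by (rule someI_ex) (use that in blast)
  have near: "near y \<in> F" "e y (near y) < \<epsilon>" if "y \<in> Y" for y
    using ex[OF F(3)[OF that]] F(3)[OF that] by (simp_all add: near_def)
  have near': "near y \<in> insert undefined F" for y
    using ex[of y] by (cases "\<exists>z\<in>F. e y z < \<epsilon>") (simp_all add: near_def)
  \<comment> \<open>A map is coded by a modulus of continuity and by its rounded values on the net for that modulus.\<close>
  define c where "c f = (let m = LEAST m. tame f m in (m, \<lambda>x\<in>E m. near (f x)))" for f
  have "c f \<in> Pair (LEAST m. tame f m) ` (E (LEAST m. tame f m) \<rightarrow>\<^sub>E insert undefined F)" for f
    unfolding c_def Let_def by  (intro imageI restrict_PiE_iff[THEN iffD2] ballI near')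
  then have "range c \<subseteq> (\<Union>m. Pair m ` (E m \<rightarrow>\<^sub>E insert undefined F))" by blast
  moreover have "countable (\<Union>m. Pair m ` (E m \<rightarrow>\<^sub>E insert undefined F))"
    using F(1) E(1) by (intro countable_UN countable_image countable_PiE) auto
  ultimately have "countable (range c)" by (rule countable_subset)
  moreover have "e (f x) (g x) < 4 * \<epsilon>"
    if f: "continuous_map mtopology Y.mtopology f" and g: "continuous_map mtopology Y.mtopology g"
      and eq: "c f = c g" and x: "x \<in> M" for f g x
  proof -
    have tame: "tame h (LEAST m. tame h m)" if h: "continuous_map mtopology Y.mtopology h" for h
    proof -
      obtain \<delta> where \<delta>: "\<delta> > 0" "\<And>x y. \<lbrakk>x \<in> M; y \<in> M; d x y < \<delta>\<rbrakk> \<Longrightarrow> e (h x) (h y) < \<epsilon>"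
        using compact_uniformly_continuous[OF cpt Y h \<epsilon>] by blast
      obtain m where "1 / real (Suc m) < \<delta>" using nat_approx_posE \<delta>(1) by blast
      then have "tame h m" using \<delta>(2) unfolding tame_def by force
      then show ?thesis by (rule LeastI[of "tame h"])
    qed
    define m where "m = (LEAST m. tame f m)"
    have m: "tame f m" "tame g m" "(\<lambda>x\<in>E m. near (f x)) = (\<lambda>x\<in>E m. near (g x))"
      using tame[OF f] tame[OF g] eq by (auto simp: c_def Let_def m_def)
    obtain y where y: "y \<in> E m" "d x y < 1 / Suc m" using E(3)[OF x] by blast
    have yM: "y \<in> M" using y E(2) by blast
    have in_Y: "f x \<in> Y" "f y \<in> Y" "g x \<in> Y" "g y \<in> Y"
      using f g x yM by (auto simp: continuous_map_def)
    have n: "near (f y) = near (g y)" using fun_cong[OF m(3), of y] y by simp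
    have nY: "near (f y) \<in> Y" using near in_Y F(2) by blast
    have "e (f x) (f y) < \<epsilon>" "e (g x) (g y) < \<epsilon>"
      using m(1,2) x yM y(2) unfolding tame_def by blast+
    moreover have "e (f y) (near (f y)) < \<epsilon>" "e (g y) (near (f y)) < \<epsilon>"
      using near[of "f y"] near[of "g y"] in_Y n by auto
    moreover have "e (f x) (g x) \<le> e (f x) (f y) + e (f y) (near (f y)) + e (g y) (near (f y)) + e (g x) (g y)"
      using Y.triangle[of "f x" "f y" "g x"] Y.triangle[of "f y" "near (f y)" "g x"]
        Y.triangle[of "near (f y)" "g y" "g x"] Y.commute[of "g y" "near (f y)"]
        Y.commute[of "g y" "g x"] in_Y nY by linarith
    ultimately show ?thesis by linarith
  qed
  ultimately show thesis by (rule that)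
qed

text \<open>
  The supremum is taken in \<^typ>\<open>ennreal\<close> so that it is 0 on the empty set and the function is
  nonnegative for all arguments, as the axioms of \<^locale>\<open>Metric_space\<close> require.
\<close>

definition sup_dist :: "('b \<Rightarrow> 'a) \<Rightarrow> ('b \<Rightarrow> 'a) \<Rightarrow> 'b set \<Rightarrow> real" where
  "sup_dist f g T = enn2real (SUP x\<in>T. ennreal (d (f x) (g x)))"

lemma sup_dist_nonneg: "0 \<le> sup_dist f g T"
  by (simp add: sup_dist_def)

lemma sup_dist_commute: "sup_dist f g T = sup_dist g f T"
  by (simp add: sup_dist_def commute)

lemma sup_dist_le: "\<lbrakk>0 \<le> c; \<And>x. x \<in> T \<Longrightarrow> d (f x) (g x) \<le> c\<rbrakk> \<Longrightarrow> sup_dist f g T \<le> c"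
  unfolding sup_dist_def by (intro enn2real_leI SUP_least ennreal_leI)

lemma le_sup_dist:
  assumes "compact_space mtopology" "f ` T \<subseteq> M" "g ` T \<subseteq> M" "x \<in> T"
  shows "d (f x) (g x) \<le> sup_dist f g T"
proof -
  have "mbounded M" using assms(1) compactin_imp_mbounded by (simp add: compact_space_def)
  then obtain B where B: "\<And>x y. \<lbrakk>x \<in> M; y \<in> M\<rbrakk> \<Longrightarrow> d x y \<le> B" unfolding mbounded_alt by blast
  have "(SUP x\<in>T. ennreal (d (f x) (g x))) \<le> ennreal B"
    using assms by (intro SUP_least ennreal_leI B) auto
  then have "(SUP x\<in>T. ennreal (d (f x) (g x))) < \<infinity>"
    by (rule le_less_trans) simp
  then have "ennreal (d (f x) (g x)) \<le> ennreal (sup_dist f g T)"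
    unfolding sup_dist_def using SUP_upper[OF assms(4), of "\<lambda>x. ennreal (d (f x) (g x))"]
    by (simp add: less_top)
  then show ?thesis by (simp add: sup_dist_nonneg)
qed

end

section \<open>The group of homeomorphisms that preserve null sets\<close>

text \<open>
  The inverse in the group \<^const>\<open>BijGroup\<close>.
\<close>

definition homeo_inv :: "'a topology \<Rightarrow> ('a \<Rightarrow> 'a) \<Rightarrow> 'a \<Rightarrow> 'a" where
  "homeo_inv X g = (\<lambda>x\<in>topspace X. inv_into (topspace X) g x)"

lemma homeo_homeomorphic_map: "g \<in> homeo X \<Longrightarrow> homeomorphic_map X X g"
  by (simp add: homeo_def)

lemma homeo_continuous_map: "g \<in> homeo X \<Longrightarrow> continuous_map X X g"
  by (rule homeomorphic_imp_continuous_map[OF homeo_homeomorphic_map])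

lemma homeo_bij_betw: "g \<in> homeo X \<Longrightarrow> bij_betw g (topspace X) (topspace X)"
  using homeomorphic_imp_injective_map[OF homeo_homeomorphic_map, of g X]
    homeomorphic_imp_surjective_map[OF homeo_homeomorphic_map, of g X]
  by (simp add: bij_betw_def)

lemma homeo_image: "g \<in> homeo X \<Longrightarrow> g ` topspace X = topspace X"
  using homeo_bij_betw by (auto simp: bij_betw_def)

lemma homeo_into: "\<lbrakk>g \<in> homeo X; x \<in> topspace X\<rbrakk> \<Longrightarrow> g x \<in> topspace X"
  using homeo_image by blast

lemma homeo_subset_Bij: "homeo X \<subseteq> Bij (topspace X)"
  using homeo_bij_betw by (auto simp: Bij_def homeo_def)

lemma homeo_inv_left: "\<lbrakk>g \<in> homeo X; x \<in> topspace X\<rbrakk> \<Longrightarrow> homeo_inv X g (g x) = x"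
  using homeo_bij_betw[of g X] by (simp add: homeo_inv_def homeo_into bij_betw_def)

lemma homeo_inv_right: "\<lbrakk>g \<in> homeo X; x \<in> topspace X\<rbrakk> \<Longrightarrow> g (homeo_inv X g x) = x"
  by (simp add: homeo_inv_def f_inv_into_f homeo_image)

lemma homeo_inv_homeo:
  assumes g: "g \<in> homeo X"
  shows "homeo_inv X g \<in> homeo X"
proof -
  obtain g' where g': "homeomorphic_maps X X g g'"
    using homeo_homeomorphic_map[OF g] by (auto simp: homeomorphic_map_maps)
  have "g' x = homeo_inv X g x" if "x \<in> topspace X" for x
  proof -
    have "g' x \<in> topspace X" "g (g' x) = x"
      using g' that continuous_map_image_subset_topspace[of X X g']
      by (auto simp: homeomorphic_maps_def)
    then show ?thesis using homeo_inv_left[OF g, of "g' x"] by simp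
  qed
  then have "homeomorphic_map X X (homeo_inv X g)"
    using g' by (auto simp: homeomorphic_maps_map intro: homeomorphic_map_eq[of X X g'])
  then show ?thesis by (simp add: homeo_def homeo_inv_def)
qed

lemma homeo_compose:
  assumes "g \<in> homeo X" "h \<in> homeo X"
  shows "compose (topspace X) g h \<in> homeo X"
proof -
  have "homeomorphic_map X X (g \<circ> h)"
    by (rule homeomorphic_map_compose[OF homeo_homeomorphic_map homeo_homeomorphic_map]) fact+
  then have "homeomorphic_map X X (compose (topspace X) g h)"
    by (rule homeomorphic_map_eq) (simp add: compose_def)
  then show ?thesis by (simp add: homeo_def)
qed

lemma homeo_id: "(\<lambda>x\<in>topspace X. x) \<in> homeo X"
proof -
  have "homeomorphic_map X X (\<lambda>x\<in>topspace X. x)"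
    by (rule homeomorphic_map_eq[of _ _ id]) auto
  then show ?thesis by (simp add: homeo_def)
qed

lemma homeo_eqI:
  "\<lbrakk>g \<in> homeo X; h \<in> homeo X; \<And>x. x \<in> topspace X \<Longrightarrow> g x = h x\<rbrakk> \<Longrightarrow> g = h"
  by (rule extensionalityI[of _ "topspace X"]) (auto simp: homeo_def)

lemma homeo_inv_inv:
  assumes g: "g \<in> homeo X"
  shows "homeo_inv X (homeo_inv X g) = g"
proof (rule homeo_eqI[of _ X])
  have gi: "homeo_inv X g \<in> homeo X" by (rule homeo_inv_homeo[OF g])
  then show "homeo_inv X (homeo_inv X g) \<in> homeo X" by (rule homeo_inv_homeo)
  fix x assume x: "x \<in> topspace X"
  show "homeo_inv X (homeo_inv X g) x = g x"
    using homeo_inv_left[OF gi homeo_into[OF g x]] homeo_inv_left[OF g x] by simp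
qed (rule g)

lemma homeo_image_eq_vimage:
  assumes g: "g \<in> homeo X" and A: "A \<subseteq> topspace X"
  shows "g ` A = homeo_inv X g -` A \<inter> topspace X"
proof (intro equalityI subsetI)
  fix y assume "y \<in> g ` A"
  then show "y \<in> homeo_inv X g -` A \<inter> topspace X"
    using A homeo_inv_left[OF g] homeo_into[OF g] by auto
next
  fix y assume "y \<in> homeo_inv X g -` A \<inter> topspace X"
  then have "homeo_inv X g y \<in> A" and eq: "g (homeo_inv X g y) = y"
    using homeo_inv_right[OF g, of y] by auto
  then have "g (homeo_inv X g y) \<in> g ` A" by (intro imageI)
  then show "y \<in> g ` A" unfolding eq .
qed

lemma inv_homeo_image_image:
  assumes g: "g \<in> homeo X" and A: "A \<subseteq> topspace X"
  shows "homeo_inv X g ` g ` A = A" "g ` homeo_inv X g ` A = A"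
proof -
  have "homeo_inv X g (g x) = x" "g (homeo_inv X g x) = x" if "x \<in> A" for x
    using homeo_inv_left[OF g] homeo_inv_right[OF g] A that by auto
  then show "homeo_inv X g ` g ` A = A" "g ` homeo_inv X g ` A = A"
    by (simp_all add: image_image)
qed

locale finite_borel_measure = finite_measure M for X :: "'a topology" and M :: "'a measure" +
  assumes sets_M: "sets M = sets (borel_of X)"
begin

lemma space_M: "space M = topspace X"
  using sets_M by (auto dest: sets_eq_imp_space_eq)

lemma homeo_measurable: "g \<in> homeo X \<Longrightarrow> g \<in> measurable M M"
  using continuous_map_measurable_borel_of[OF homeo_continuous_map, of g X]
  by (simp cong: measurable_cong_sets add: measurable_cong_sets[OF sets_M sets_M])

lemma homeo_image_sets:
  assumes "g \<in> homeo X" "A \<in> sets M"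
  shows "g ` A \<in> sets M"
  using measurable_sets[OF homeo_measurable[OF homeo_inv_homeo[OF assms(1)]] assms(2)]
    homeo_image_eq_vimage[OF assms(1), of A] sets.sets_into_space[OF assms(2)]
  by (simp add: space_M)

lemma homeo_bac_homeo: "g \<in> homeo_bac X M \<Longrightarrow> g \<in> homeo X"
  unfolding homeo_bac_def by (elim CollectE conjE)

text \<open>
  The defining property of \<^const>\<open>homeo_bac\<close> with the image on the left, the direction in which it
  terminates as a rewrite rule.
\<close>

lemma homeo_bac_null_iff:
  assumes "g \<in> homeo_bac X M" "A \<in> sets M"
  shows "emeasure M (g ` A) = 0 \<longleftrightarrow> emeasure M A = 0"
proof -
  from assms(1) have "\<forall>A\<in>sets M. emeasure M A = 0 \<longleftrightarrow> emeasure M (g ` A) = 0"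
    unfolding homeo_bac_def by (elim CollectE conjE)
  from bspec[OF this assms(2)] show ?thesis by (rule sym)
qed

lemma homeo_bacI:
  assumes "g \<in> homeo X" "\<And>A. A \<in> sets M \<Longrightarrow> emeasure M (g ` A) = 0 \<longleftrightarrow> emeasure M A = 0"
  shows "g \<in> homeo_bac X M"
  unfolding homeo_bac_def by (intro CollectI conjI ballI assms(1)) (rule assms(2)[symmetric])

lemma homeo_bac_inv:
  assumes g: "g \<in> homeo_bac X M"
  shows "homeo_inv X g \<in> homeo_bac X M"
proof (rule homeo_bacI)
  have gh: "g \<in> homeo X" using g by (rule homeo_bac_homeo)
  show gi: "homeo_inv X g \<in> homeo X" by (rule homeo_inv_homeo[OF gh])
  fix A assume A: "A \<in> sets M"
  have "g ` homeo_inv X g ` A = A"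
    using sets.sets_into_space[OF A] by (intro inv_homeo_image_image gh) (simp add: space_M)
  then show "emeasure M (homeo_inv X g ` A) = 0 \<longleftrightarrow> emeasure M A = 0"
    using homeo_bac_null_iff[OF g homeo_image_sets[OF gi A]] by simp
qed

lemma image_compose: "A \<in> sets M \<Longrightarrow> compose (topspace X) g h ` A = g ` h ` A"
  using sets.sets_into_space[of A M] by (auto simp: compose_def space_M image_image)

lemma homeo_bac_compose:
  assumes g: "g \<in> homeo_bac X M" and h: "h \<in> homeo_bac X M"
  shows "compose (topspace X) g h \<in> homeo_bac X M"
proof (rule homeo_bacI)
  have gh: "g \<in> homeo X" "h \<in> homeo X" using g h by (auto intro: homeo_bac_homeo)
  then show "compose (topspace X) g h \<in> homeo X" by (rule homeo_compose)
  fix A assume A: "A \<in> sets M"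
  show "emeasure M (compose (topspace X) g h ` A) = 0 \<longleftrightarrow> emeasure M A = 0"
    by (simp add: image_compose A homeo_bac_null_iff g h homeo_image_sets gh)
qed

lemma homeo_bac_id: "(\<lambda>x\<in>topspace X. x) \<in> homeo_bac X M"
proof -
  have "(\<lambda>x\<in>topspace X. x) ` A = A" if "A \<in> sets M" for A
    using sets.sets_into_space[OF that] by (auto simp: space_M)
  then show ?thesis by (intro homeo_bacI homeo_id) simp
qed

lemma subgroup_homeo_bac: "subgroup (homeo_bac X M) (BijGroup (topspace X))"
proof (rule subgroup.intro)
  have sub: "homeo_bac X M \<subseteq> Bij (topspace X)"
    using homeo_subset_Bij homeo_bac_homeo by blast
  then show "homeo_bac X M \<subseteq> carrier (BijGroup (topspace X))" by (simp add: BijGroup_def)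
  show "\<one>\<^bsub>BijGroup (topspace X)\<^esub> \<in> homeo_bac X M" by (simp add: BijGroup_def homeo_bac_id)
  show "g \<otimes>\<^bsub>BijGroup (topspace X)\<^esub> h \<in> homeo_bac X M"
    if "g \<in> homeo_bac X M" "h \<in> homeo_bac X M" for g h
    using homeo_bac_compose[OF that] that sub by (auto simp: BijGroup_def)
  show "inv\<^bsub>BijGroup (topspace X)\<^esub> g \<in> homeo_bac X M" if "g \<in> homeo_bac X M" for g
    using homeo_bac_inv[OF that] that sub by (auto simp: inv_BijGroup homeo_inv_def subset_iff)
qed

lemma homeo_bac_group:
  shows "group (homeo_bac_group X M)" "carrier (homeo_bac_group X M) = homeo_bac X M"
    and "\<lbrakk>g \<in> homeo_bac X M; h \<in> homeo_bac X M\<rbrakk>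
      \<Longrightarrow> g \<otimes>\<^bsub>homeo_bac_group X M\<^esub> h = compose (topspace X) g h"
    and "g \<in> homeo_bac X M \<Longrightarrow> inv\<^bsub>homeo_bac_group X M\<^esub> g = homeo_inv X g"
proof -
  have sub: "homeo_bac X M \<subseteq> Bij (topspace X)"
    using homeo_subset_Bij homeo_bac_homeo by blast
  show "group (homeo_bac_group X M)" unfolding homeo_bac_group_def
    by (rule subgroup.subgroup_is_group[OF subgroup_homeo_bac group_BijGroup])
  show "carrier (homeo_bac_group X M) = homeo_bac X M" by (simp add: homeo_bac_group_def)
  show "g \<otimes>\<^bsub>homeo_bac_group X M\<^esub> h = compose (topspace X) g h"
    if "g \<in> homeo_bac X M" "h \<in> homeo_bac X M"
    using that sub by (auto simp: homeo_bac_group_def BijGroup_def)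
  show "inv\<^bsub>homeo_bac_group X M\<^esub> g = homeo_inv X g" if "g \<in> homeo_bac X M"
    using group.m_inv_consistent[OF group_BijGroup subgroup_homeo_bac that] that sub
    by (auto simp: homeo_bac_group_def inv_BijGroup homeo_inv_def)
qed

section \<open>Radon-Nikodym derivatives and the action on integrable functions\<close>

lemma pullback_measure_eq_distr: "pullback_measure M g = distr M M (homeo_inv X g)"
  unfolding pullback_measure_def by (rule distr_cong) (simp_all add: space_M homeo_inv_def)

lemma sets_pullback_measure [simp]: "sets (pullback_measure M g) = sets M"
  by (simp add: pullback_measure_def)

lemma emeasure_pullback_measure:
  assumes g: "g \<in> homeo X" and A: "A \<in> sets M"
  shows "emeasure (pullback_measure M g) A = emeasure M (g ` A)"
  unfolding pullback_measure_eq_distr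
  using emeasure_distr[OF homeo_measurable[OF homeo_inv_homeo[OF g]] A]
    homeo_image_eq_vimage[OF g, of A] sets.sets_into_space[OF A]
  by (simp add: space_M)

lemma finite_pullback_measure:
  assumes g: "g \<in> homeo X"
  shows "finite_measure (pullback_measure M g)"
  unfolding pullback_measure_eq_distr
  by (rule finite_measure_distr[OF homeo_measurable[OF homeo_inv_homeo[OF g]]])

lemma homeo_deriv_measurable [measurable]: "homeo_deriv M g \<in> borel_measurable M"
  unfolding homeo_deriv_def by measurable

lemma homeo_deriv_nonneg [simp]: "0 \<le> homeo_deriv M g x"
  by (simp add: homeo_deriv_def)

lemma density_homeo_deriv:
  assumes g: "g \<in> homeo_bac X M"
  shows "density M (\<lambda>x. ennreal (homeo_deriv M g x)) = pullback_measure M g"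
proof -
  have gh: "g \<in> homeo X" using g by (rule homeo_bac_homeo)
  interpret N: finite_measure "pullback_measure M g" by (rule finite_pullback_measure[OF gh])
  have ac: "absolutely_continuous M (pullback_measure M g)"
    unfolding absolutely_continuous_def
    by (auto simp: null_sets_def emeasure_pullback_measure[OF gh] homeo_bac_null_iff[OF g])
  have "AE x in M. RN_deriv M (pullback_measure M g) x \<noteq> \<infinity>"
    by (intro RN_deriv_finite N.sigma_finite_measure_axioms ac) simp
  then have "density M (\<lambda>x. ennreal (homeo_deriv M g x)) = density M (RN_deriv M (pullback_measure M g))"
    by (intro density_cong) (auto simp: homeo_deriv_def less_top[symmetric])
  also have "\<dots> = pullback_measure M g" by (intro density_RN_deriv ac) simp
  finally show ?thesis .
qed

text \<open>
  Uniqueness is the way in which all derivatives below are computed: a nonnegative density of the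
  pullback measure is the derivative almost everywhere.
\<close>

lemma homeo_deriv_unique:
  assumes "f \<in> borel_measurable M" "\<And>x. x \<in> space M \<Longrightarrow> 0 \<le> f x"
    and "density M (\<lambda>x. ennreal (f x)) = pullback_measure M g"
  shows "AE x in M. homeo_deriv M g x = f x"
proof -
  have "AE x in M. ennreal (f x) = RN_deriv M (pullback_measure M g) x"
    by (rule RN_deriv_unique) (use assms in auto)
  then show ?thesis
    using AE_space by eventually_elim (metis assms(2) enn2real_ennreal homeo_deriv_def)
qed

text \<open>
  The action of a homeomorphism on \<open>L\<^sup>1\<close>: by the change of variables it is isometric. The chain
  rule below says that the derivative is a cocycle for this action, and this turns both group
  operations into statements about it.
\<close>

definition transfer :: "('a \<Rightarrow> 'a) \<Rightarrow> ('a \<Rightarrow> real) \<Rightarrow> 'a \<Rightarrow> real" where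
  "transfer g f x = homeo_deriv M g x * f (g x)"

lemma nn_integral_homeo:
  assumes g: "g \<in> homeo_bac X M" and [measurable]: "u \<in> borel_measurable M"
  shows "(\<integral>\<^sup>+x. ennreal (homeo_deriv M g x) * u (g x) \<partial>M) = (\<integral>\<^sup>+x. u x \<partial>M)"
proof -
  have gh: "g \<in> homeo X" using g by (rule homeo_bac_homeo)
  have [measurable]: "g \<in> measurable M M" "homeo_inv X g \<in> measurable M M"
    using gh homeo_inv_homeo homeo_measurable by auto
  have "(\<integral>\<^sup>+x. ennreal (homeo_deriv M g x) * u (g x) \<partial>M) = (\<integral>\<^sup>+x. u (g x) \<partial>pullback_measure M g)"
    by (simp add: density_homeo_deriv[OF g, symmetric] nn_integral_density)
  also have "\<dots> = (\<integral>\<^sup>+x. u (g (homeo_inv X g x)) \<partial>M)"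
    unfolding pullback_measure_eq_distr by (rule nn_integral_distr) auto
  also have "\<dots> = (\<integral>\<^sup>+x. u x \<partial>M)"
    by (rule nn_integral_cong) (simp add: space_M homeo_inv_right[OF gh])
  finally show ?thesis .
qed

lemma transfer_integrable:
  assumes g: "g \<in> homeo_bac X M" and u: "integrable M u"
  shows "integrable M (transfer g u)" "integral\<^sup>L M (transfer g u) = integral\<^sup>L M u"
proof -
  have gh: "g \<in> homeo X" using g by (rule homeo_bac_homeo)
  have [measurable]: "g \<in> measurable M M" "homeo_inv X g \<in> measurable M M" "u \<in> borel_measurable M"
    using gh homeo_inv_homeo homeo_measurable u by auto
  have cong: "u (g (homeo_inv X g x)) = u x" if "x \<in> space M" for x
    using that by (simp add: space_M homeo_inv_right[OF gh])
  have "integrable M (transfer g u) \<longleftrightarrow> integrable (pullback_measure M g) (\<lambda>x. u (g x))"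
    unfolding density_homeo_deriv[OF g, symmetric] transfer_def by (subst integrable_density) auto
  also have "\<dots> \<longleftrightarrow> integrable M (\<lambda>x. u (g (homeo_inv X g x)))"
    unfolding pullback_measure_eq_distr by (rule integrable_distr_eq) auto
  also have "\<dots> \<longleftrightarrow> integrable M u" by (rule Bochner_Integration.integrable_cong) (simp_all add: cong)
  finally show "integrable M (transfer g u)" using u by simp
  have "integral\<^sup>L M (transfer g u) = (\<integral>x. u (g x) \<partial>pullback_measure M g)"
    unfolding density_homeo_deriv[OF g, symmetric] transfer_def by (subst integral_density) auto
  also have "\<dots> = (\<integral>x. u (g (homeo_inv X g x)) \<partial>M)"
    unfolding pullback_measure_eq_distr by (rule integral_distr) auto
  also have "\<dots> = integral\<^sup>L M u" by (rule Bochner_Integration.integral_cong) (simp_all add: cong)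
  finally show "integral\<^sup>L M (transfer g u) = integral\<^sup>L M u" .
qed

lemma transfer_isometry:
  assumes g: "g \<in> homeo_bac X M" and "integrable M u" "integrable M v"
  shows "(LINT x|M. \<bar>transfer g u x - transfer g v x\<bar>) = (LINT x|M. \<bar>u x - v x\<bar>)"
proof -
  have "\<bar>transfer g u x - transfer g v x\<bar> = transfer g (\<lambda>x. \<bar>u x - v x\<bar>) x" for x
    by (simp add: transfer_def abs_mult flip: right_diff_distrib)
  then show ?thesis using transfer_integrable(2)[OF g, of "\<lambda>x. \<bar>u x - v x\<bar>"] assms by simp
qed

lemma homeo_deriv_integrable [simp]:
  assumes g: "g \<in> homeo_bac X M"
  shows "integrable M (homeo_deriv M g)"
  using transfer_integrable(1)[OF g, of "\<lambda>_. 1"] by (simp add: transfer_def[abs_def])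

lemma integral_homeo_deriv:
  assumes g: "g \<in> homeo_bac X M"
  shows "integral\<^sup>L M (homeo_deriv M g) = measure M (space M)"
  using transfer_integrable(2)[OF g, of "\<lambda>_. 1"] by (simp add: transfer_def[abs_def])

text \<open>
  The chain rule. By uniqueness it suffices to integrate the right-hand side over a set \<open>A\<close>; changing
  variables along \<open>h\<close> gives the integral of \<open>D(g)\<close> over \<open>h A\<close>, that is, the measure of \<open>g (h A)\<close>.
\<close>

lemma homeo_deriv_compose:
  assumes g: "g \<in> homeo_bac X M" and h: "h \<in> homeo_bac X M"
  shows "AE x in M. homeo_deriv M (compose (topspace X) g h) x = transfer h (homeo_deriv M g) x"
proof (rule homeo_deriv_unique)
  have hh: "h \<in> homeo X" and gh: "g \<in> homeo X" using g h by (auto intro: homeo_bac_homeo)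
  have [measurable]: "h \<in> measurable M M" by (rule homeo_measurable[OF hh])
  show "transfer h (homeo_deriv M g) \<in> borel_measurable M" unfolding transfer_def by measurable
  show "0 \<le> transfer h (homeo_deriv M g) x" for x by (simp add: transfer_def)
  show "density M (\<lambda>x. ennreal (transfer h (homeo_deriv M g) x)) =
      pullback_measure M (compose (topspace X) g h)"
  proof (rule measure_eqI)
    fix A assume "A \<in> sets (density M (\<lambda>x. ennreal (transfer h (homeo_deriv M g) x)))"
    then have A [measurable]: "A \<in> sets M" by simp
    have hA [measurable]: "h ` A \<in> sets M" by (rule homeo_image_sets[OF hh A])
    have mem: "h x \<in> h ` A \<longleftrightarrow> x \<in> A" if "x \<in> space M" for x
      using homeo_bij_betw[OF hh] sets.sets_into_space[OF A] that
      by (intro inj_on_image_mem_iff) (auto simp: bij_betw_def space_M)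
    have "emeasure (density M (\<lambda>x. ennreal (transfer h (homeo_deriv M g) x))) A =
        (\<integral>\<^sup>+x. ennreal (transfer h (homeo_deriv M g) x) * indicator A x \<partial>M)"
      unfolding transfer_def by (rule emeasure_density) auto
    also have "\<dots> = (\<integral>\<^sup>+x. ennreal (homeo_deriv M h x) *
        (ennreal (homeo_deriv M g (h x)) * indicator (h ` A) (h x)) \<partial>M)"
      by (rule nn_integral_cong)
        (simp add: transfer_def ennreal_mult mem mult.assoc split: split_indicator)
    also have "\<dots> = (\<integral>\<^sup>+x. ennreal (homeo_deriv M g x) * indicator (h ` A) x \<partial>M)"
      by (rule nn_integral_homeo[OF h]) measurable
    also have "\<dots> = emeasure (pullback_measure M g) (h ` A)"
      by (simp add: density_homeo_deriv[OF g, symmetric] emeasure_density)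
    also have "\<dots> = emeasure (pullback_measure M (compose (topspace X) g h)) A"
      by (simp add: emeasure_pullback_measure gh hh homeo_compose image_compose)
    finally show "emeasure (density M (\<lambda>x. ennreal (transfer h (homeo_deriv M g) x))) A =
      emeasure (pullback_measure M (compose (topspace X) g h)) A" .
  qed simp
qed

lemma homeo_deriv_id: "AE x in M. homeo_deriv M (\<lambda>x\<in>topspace X. x) x = 1"
proof (rule homeo_deriv_unique)
  have id: "(\<lambda>x\<in>topspace X. x) ` A = A" if "A \<in> sets M" for A
    using sets.sets_into_space[OF that] by (auto simp: space_M)
  show "density M (\<lambda>x. ennreal 1) = pullback_measure M (\<lambda>x\<in>topspace X. x)"
  proof (rule measure_eqI)
    fix A assume "A \<in> sets (density M (\<lambda>x. ennreal 1))"
    then have A: "A \<in> sets M" by simp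
    show "emeasure (density M (\<lambda>x. ennreal 1)) A = emeasure (pullback_measure M (\<lambda>x\<in>topspace X. x)) A"
      unfolding emeasure_pullback_measure[OF homeo_id A] id[OF A] using A by (simp add: emeasure_density)
  qed simp
qed auto

end

section \<open>A metric for which the group operations are continuous\<close>

locale compact_metric_measure =
  Metric_space S d + finite_borel_measure "Metric_space.mtopology S d" M
  for S :: "'a set" and d and M :: "'a measure" +
  assumes compact: "compact_space mtopology"
begin

abbreviation "\<H> \<equiv> homeo_bac mtopology M"

definition ac_dist :: "('a \<Rightarrow> 'a) \<Rightarrow> ('a \<Rightarrow> 'a) \<Rightarrow> real" where
  "ac_dist g h = sup_dist g h S + rho_ac M g h"

lemma homeo_bac_into: "\<lbrakk>g \<in> \<H>; x \<in> S\<rbrakk> \<Longrightarrow> g x \<in> S"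
  using homeo_into[OF homeo_bac_homeo, of g x] by simp

lemma homeo_bac_continuous_map: "g \<in> \<H> \<Longrightarrow> continuous_map mtopology mtopology g"
  by (rule homeo_continuous_map[OF homeo_bac_homeo])

lemma homeo_bac_le_sup_dist: "\<lbrakk>g \<in> \<H>; h \<in> \<H>; x \<in> S\<rbrakk> \<Longrightarrow> d (g x) (h x) \<le> sup_dist g h S"
  by (intro le_sup_dist compact) (auto simp: homeo_bac_into)

lemma rho_ac_nonneg: "0 \<le> rho_ac M g h"
  by (simp add: rho_ac_def)

lemma rho_ac_commute: "rho_ac M g h = rho_ac M h g"
  by (simp add: rho_ac_def abs_minus_commute)

lemma rho_ac_triangle:
  assumes "g \<in> \<H>" "h \<in> \<H>" "k \<in> \<H>"
  shows "rho_ac M g k \<le> rho_ac M g h + rho_ac M h k"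
proof -
  have "rho_ac M g k \<le> (LINT x|M. \<bar>homeo_deriv M g x - homeo_deriv M h x\<bar> + \<bar>homeo_deriv M h x - homeo_deriv M k x\<bar>)"
    unfolding rho_ac_def by (rule integral_mono) (use assms in auto)
  then show ?thesis using assms by (simp add: rho_ac_def)
qed

lemma sup_dist_triangle:
  assumes "g \<in> \<H>" "h \<in> \<H>" "k \<in> \<H>"
  shows "sup_dist g k S \<le> sup_dist g h S + sup_dist h k S"
proof (rule sup_dist_le)
  fix x assume x: "x \<in> S"
  have "d (g x) (k x) \<le> d (g x) (h x) + d (h x) (k x)"
    by (rule triangle) (use assms x homeo_bac_into in auto)
  then show "d (g x) (k x) \<le> sup_dist g h S + sup_dist h k S"
    using homeo_bac_le_sup_dist[of g h x] homeo_bac_le_sup_dist[of h k x] assms x by linarith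
qed (simp add: sup_dist_nonneg)

sublocale ac: Metric_space \<H> ac_dist
proof
  show "0 \<le> ac_dist g h" for g h by (simp add: ac_dist_def sup_dist_nonneg rho_ac_nonneg)
  show "ac_dist g h = ac_dist h g" for g h
    by (simp add: ac_dist_def sup_dist_commute[of g] rho_ac_commute[of g])
  show "ac_dist g k \<le> ac_dist g h + ac_dist h k" if "g \<in> \<H>" "h \<in> \<H>" "k \<in> \<H>" for g h k
    unfolding ac_dist_def using sup_dist_triangle[OF that] rho_ac_triangle[OF that] by linarith
  show "ac_dist g h = 0 \<longleftrightarrow> g = h" if g: "g \<in> \<H>" and h: "h \<in> \<H>" for g h
  proof
    assume "ac_dist g h = 0"
    then have "sup_dist g h S = 0"
      unfolding ac_dist_def using sup_dist_nonneg[of g h S] rho_ac_nonneg[of g h] by linarith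
    then have "g x = h x" if "x \<in> S" for x
      using homeo_bac_le_sup_dist[OF g h that] nonneg[of "g x" "h x"] that
        zero[OF homeo_bac_into[OF g that] homeo_bac_into[OF h that]] by linarith
    then show "g = h" by (intro homeo_eqI[OF homeo_bac_homeo[OF g] homeo_bac_homeo[OF h]]) simp
  next
    assume "g = h"
    moreover have "sup_dist h h S \<le> 0" by (rule sup_dist_le) (use homeo_bac_into[OF h] in auto)
    ultimately show "ac_dist g h = 0"
      using sup_dist_nonneg[of h h S] by (simp add: ac_dist_def rho_ac_def)
  qed
qed

lemma sup_dist_le_ac_dist: "sup_dist g h S \<le> ac_dist g h"
  by (simp add: ac_dist_def rho_ac_nonneg)

lemma rho_ac_le_ac_dist: "rho_ac M g h \<le> ac_dist g h"
  by (simp add: ac_dist_def sup_dist_nonneg)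

text \<open>
  All operators of the action are isometries, so it is enough to treat a dense set of functions. For
  a continuous, hence bounded and uniformly continuous \<open>\<phi>\<close>,
  \<open>\<phi>(h' x) D(h') - \<phi>(h x) D(h) = \<phi>(h' x) (D(h') - D(h)) + (\<phi>(h' x) - \<phi>(h x)) D(h)\<close>;
  here the first summand is small in \<open>L\<^sup>1\<close> because the derivatives are close, the second because
  the maps are uniformly close.
\<close>

lemma transfer_strongly_continuous:
  assumes h: "h \<in> \<H>" and f: "integrable M f" and \<epsilon>: "\<epsilon> > 0"
  obtains \<delta> where "\<delta> > 0"
    "\<And>h'. \<lbrakk>h' \<in> \<H>; ac_dist h' h < \<delta>\<rbrakk> \<Longrightarrow> (LINT x|M. \<bar>transfer h' f x - transfer h f x\<bar>) < \<epsilon>"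
proof -
  obtain \<phi> where \<phi>: "continuous_map mtopology euclidean \<phi>" "integrable M \<phi>"
      "(LINT x|M. \<bar>f x - \<phi> x\<bar>) < \<epsilon>/4"
    using continuous_dense_L1[OF metrizable_space_mtopology finite_measure_axioms sets_M f, of "\<epsilon>/4"] \<epsilon>
    by auto
  have "compactin euclidean (\<phi> ` S)"
    using image_compactin[OF compact[unfolded compact_space_def] \<phi>(1)] by simp
  then have "bounded (\<phi> ` S)" by (simp add: compact_imp_bounded)
  then obtain B where B: "B > 0" "\<And>x. x \<in> S \<Longrightarrow> \<bar>\<phi> x\<bar> \<le> B"
    unfolding bounded_pos by auto
  define \<mu> where "\<mu> = measure M (space M)"
  have \<mu>: "\<mu> \<ge> 0" by (simp add: \<mu>_def)
  \<comment> \<open>The summand 1 keeps the denominator positive when the measure is zero.\<close>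
  define \<eta> where "\<eta> = \<epsilon> / (4 * (\<mu> + 1))"
  have \<eta>: "\<eta> > 0" using \<epsilon> \<mu> by (simp add: \<eta>_def)
  have "\<eta> * \<mu> \<le> \<eta> * (\<mu> + 1)" using \<eta> by (intro mult_left_mono) auto
  also have "\<dots> = \<epsilon>/4" using \<mu> by (simp add: \<eta>_def field_simps add_nonneg_eq_0_iff)
  finally have \<eta>\<mu>: "\<eta> * \<mu> \<le> \<epsilon>/4" .
  obtain \<delta>0 where \<delta>0: "\<delta>0 > 0" "\<And>x y. \<lbrakk>x \<in> S; y \<in> S; d x y < \<delta>0\<rbrakk> \<Longrightarrow> \<bar>\<phi> x - \<phi> y\<bar> < \<eta>"
    by (rule compact_uniformly_continuous_real[OF compact \<phi>(1) \<eta>]) blast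
  define \<delta> where "\<delta> = min \<delta>0 (\<epsilon> / (4 * B))"
  have "\<delta> > 0" using \<delta>0(1) \<epsilon> B(1) by (simp add: \<delta>_def)
  moreover have "(LINT x|M. \<bar>transfer h' f x - transfer h f x\<bar>) < \<epsilon>"
    if h': "h' \<in> \<H>" and close: "ac_dist h' h < \<delta>" for h'
  proof -
    have int: "integrable M (transfer k u)" if "k \<in> \<H>" "integrable M u" for k u
      using that by (rule transfer_integrable)
    note [simp] = int[OF h' f] int[OF h f] int[OF h' \<phi>(2)] int[OF h \<phi>(2)] h h'
    \<comment> \<open>Replace \<open>f\<close> by \<open>\<phi>\<close> on both sides and split the difference of the products.\<close>
    have pt: "\<bar>transfer h' f x - transfer h f x\<bar> \<le>
        \<bar>transfer h' f x - transfer h' \<phi> x\<bar> + B * \<bar>homeo_deriv M h' x - homeo_deriv M h x\<bar> +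
        \<eta> * homeo_deriv M h x + \<bar>transfer h f x - transfer h \<phi> x\<bar>" if "x \<in> space M" for x
    proof -
      have x: "x \<in> S" using that by (simp add: space_M)
      have "d (h' x) (h x) < \<delta>0"
        using homeo_bac_le_sup_dist[OF h' h x] sup_dist_le_ac_dist[of h' h] close by (simp add: \<delta>_def)
      then have "\<bar>\<phi> (h' x) - \<phi> (h x)\<bar> < \<eta>"
        by (rule \<delta>0(2)[OF homeo_bac_into[OF h' x] homeo_bac_into[OF h x]])
      then have 1: "\<bar>homeo_deriv M h x * (\<phi> (h' x) - \<phi> (h x))\<bar> \<le> \<eta> * homeo_deriv M h x"
        by (subst mult.commute) (simp add: abs_mult mult_right_mono)
      have 2: "\<bar>(homeo_deriv M h' x - homeo_deriv M h x) * \<phi> (h' x)\<bar> \<le>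
          B * \<bar>homeo_deriv M h' x - homeo_deriv M h x\<bar>"
        using B(2)[OF homeo_bac_into[OF h' x]] by (simp add: abs_mult mult.commute mult_right_mono)
      have "transfer h' \<phi> x - transfer h \<phi> x = (homeo_deriv M h' x - homeo_deriv M h x) * \<phi> (h' x) +
          homeo_deriv M h x * (\<phi> (h' x) - \<phi> (h x))"
        by (simp add: transfer_def algebra_simps)
      with 1 2 show ?thesis by linarith
    qed
    have "(LINT x|M. \<bar>transfer h' f x - transfer h f x\<bar>) \<le>
        (LINT x|M. \<bar>transfer h' f x - transfer h' \<phi> x\<bar> + B * \<bar>homeo_deriv M h' x - homeo_deriv M h x\<bar> +
        \<eta> * homeo_deriv M h x + \<bar>transfer h f x - transfer h \<phi> x\<bar>)"
      by (rule integral_mono) (use pt in auto)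
    also have "\<dots> = (LINT x|M. \<bar>f x - \<phi> x\<bar>) + B * rho_ac M h' h + \<eta> * \<mu> + (LINT x|M. \<bar>f x - \<phi> x\<bar>)"
      using f \<phi>(2) by (simp add: transfer_isometry rho_ac_def integral_homeo_deriv \<mu>_def)
    also have "B * rho_ac M h' h \<le> B * (\<epsilon> / (4 * B))"
      using close rho_ac_le_ac_dist[of h' h] B(1) by (intro mult_left_mono) (auto simp: \<delta>_def)
    also have "B * (\<epsilon> / (4 * B)) = \<epsilon>/4" using B(1) by simp
    finally show ?thesis using \<phi>(3) \<eta>\<mu> by linarith
  qed
  ultimately show thesis by (rule that)
qed

lemma homeo_bac_uniformly_continuous:
  assumes g: "g \<in> \<H>" and \<epsilon>: "\<epsilon> > 0"
  obtains \<delta> where "\<delta> > 0" "\<And>x y. \<lbrakk>x \<in> S; y \<in> S; d x y < \<delta>\<rbrakk> \<Longrightarrow> d (g x) (g y) < \<epsilon>"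
  by (rule compact_uniformly_continuous[OF compact Metric_space_axioms homeo_bac_continuous_map[OF g] \<epsilon>])
    (use that in blast)

lemma homeo_deriv_compose_inv:
  assumes g: "g \<in> \<H>"
  shows "AE x in M. transfer g (homeo_deriv M (homeo_inv mtopology g)) x = 1"
proof -
  have "compose S (homeo_inv mtopology g) g = (\<lambda>x\<in>S. x)"
    using homeo_inv_left[OF homeo_bac_homeo[OF g]] by (auto simp: compose_def)
  then show ?thesis
    using homeo_deriv_compose[OF homeo_bac_inv[OF g] g] homeo_deriv_id
    unfolding topspace_mtopology by (auto elim: eventually_elim2)
qed

text \<open>
  By the chain rule, \<open>D(g' h') - D(g h)\<close> is the transfer under \<open>h'\<close> of \<open>D(g') - D(g)\<close>, whose norm is
  unchanged, plus the difference of the transfers of \<open>D(g)\<close> under \<open>h'\<close> and \<open>h\<close>, which is small by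
  strong continuity.
\<close>

lemma ac_dist_compose_continuous:
  assumes g: "g \<in> \<H>" and h: "h \<in> \<H>" and \<epsilon>: "\<epsilon> > 0"
  obtains \<delta> where "\<delta> > 0"
    "\<And>g' h'. \<lbrakk>g' \<in> \<H>; h' \<in> \<H>; ac_dist g' g < \<delta>; ac_dist h' h < \<delta>\<rbrakk>
      \<Longrightarrow> ac_dist (compose S g' h') (compose S g h) < \<epsilon>"
proof -
  have "\<epsilon>/4 > 0" using \<epsilon> by simp
  obtain \<delta>1 where \<delta>1: "\<delta>1 > 0" "\<And>x y. \<lbrakk>x \<in> S; y \<in> S; d x y < \<delta>1\<rbrakk> \<Longrightarrow> d (g x) (g y) < \<epsilon>/4"
    by (rule homeo_bac_uniformly_continuous[OF g \<open>\<epsilon>/4 > 0\<close>]) blast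
  obtain \<delta>2 where \<delta>2: "\<delta>2 > 0" "\<And>h'. \<lbrakk>h' \<in> \<H>; ac_dist h' h < \<delta>2\<rbrakk> \<Longrightarrow>
      (LINT x|M. \<bar>transfer h' (homeo_deriv M g) x - transfer h (homeo_deriv M g) x\<bar>) < \<epsilon>/4"
    by (rule transfer_strongly_continuous[OF h homeo_deriv_integrable[OF g] \<open>\<epsilon>/4 > 0\<close>]) blast
  define \<delta> where "\<delta> = min (\<epsilon>/4) (min \<delta>1 \<delta>2)"
  have "\<delta> > 0" using \<delta>1(1) \<delta>2(1) \<epsilon> by (simp add: \<delta>_def)
  moreover have "ac_dist (compose S g' h') (compose S g h) < \<epsilon>"
    if g': "g' \<in> \<H>" and h': "h' \<in> \<H>" and close: "ac_dist g' g < \<delta>" "ac_dist h' h < \<delta>" for g' h'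
  proof -
    have "sup_dist (compose S g' h') (compose S g h) S \<le> \<epsilon>/4 + \<epsilon>/4"
    proof (rule sup_dist_le)
      fix x assume x: "x \<in> S"
      have hx: "h' x \<in> S" "h x \<in> S" using h h' x homeo_bac_into by auto
      have "d (g' (h' x)) (g (h x)) \<le> d (g' (h' x)) (g (h' x)) + d (g (h' x)) (g (h x))"
        by (rule triangle) (use g g' hx homeo_bac_into in auto)
      also have "d (g' (h' x)) (g (h' x)) \<le> \<epsilon>/4"
        using homeo_bac_le_sup_dist[OF g' g hx(1)] sup_dist_le_ac_dist[of g' g] close(1)
        by (simp add: \<delta>_def)
      also have "d (g (h' x)) (g (h x)) \<le> \<epsilon>/4"
        using homeo_bac_le_sup_dist[OF h' h x] sup_dist_le_ac_dist[of h' h] close(2)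
        by (intro less_imp_le \<delta>1(2) hx) (simp add: \<delta>_def)
      finally show "d (compose S g' h' x) (compose S g h x) \<le> \<epsilon>/4 + \<epsilon>/4"
        using x by (simp add: compose_def)
    qed (use \<epsilon> in simp)
    moreover have "rho_ac M (compose S g' h') (compose S g h) < \<epsilon>/4 + \<epsilon>/4"
    proof -
      note [simp] = g h g' h' transfer_integrable
      have "rho_ac M (compose S g' h') (compose S g h) =
          (LINT x|M. \<bar>transfer h' (homeo_deriv M g') x - transfer h (homeo_deriv M g) x\<bar>)"
        unfolding rho_ac_def
      proof (rule integral_cong_AE)
        show "AE x in M. \<bar>homeo_deriv M (compose S g' h') x - homeo_deriv M (compose S g h) x\<bar> =
            \<bar>transfer h' (homeo_deriv M g') x - transfer h (homeo_deriv M g) x\<bar>"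
          using homeo_deriv_compose[OF g' h'] homeo_deriv_compose[OF g h]
          unfolding topspace_mtopology by eventually_elim simp
      qed (auto intro!: borel_measurable_integrable)
      also have "\<dots> \<le> (LINT x|M. \<bar>transfer h' (homeo_deriv M g') x - transfer h' (homeo_deriv M g) x\<bar> +
          \<bar>transfer h' (homeo_deriv M g) x - transfer h (homeo_deriv M g) x\<bar>)"
        by (rule integral_mono) auto
      also have "\<dots> = rho_ac M g' g +
          (LINT x|M. \<bar>transfer h' (homeo_deriv M g) x - transfer h (homeo_deriv M g) x\<bar>)"
        by (simp add: transfer_isometry rho_ac_def)
      also have "\<dots> < \<epsilon>/4 + \<epsilon>/4"
        using close rho_ac_le_ac_dist[of g' g] by (intro add_strict_mono \<delta>2(2) h') (auto simp: \<delta>_def)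
      finally show ?thesis .
    qed
    ultimately show ?thesis unfolding ac_dist_def by linarith
  qed
  ultimately show thesis by (rule that)
qed

lemma ac_dist_inv_continuous:
  assumes g: "g \<in> \<H>" and \<epsilon>: "\<epsilon> > 0"
  obtains \<delta> where "\<delta> > 0"
    "\<And>g'. \<lbrakk>g' \<in> \<H>; ac_dist g' g < \<delta>\<rbrakk>
      \<Longrightarrow> ac_dist (homeo_inv mtopology g') (homeo_inv mtopology g) < \<epsilon>"
proof -
  let ?i = "homeo_inv mtopology"
  have gi: "?i g \<in> \<H>" by (rule homeo_bac_inv[OF g])
  have "\<epsilon>/2 > 0" using \<epsilon> by simp
  obtain \<delta>1 where \<delta>1: "\<delta>1 > 0" "\<And>x y. \<lbrakk>x \<in> S; y \<in> S; d x y < \<delta>1\<rbrakk> \<Longrightarrow> d (?i g x) (?i g y) < \<epsilon>/2"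
    by (rule homeo_bac_uniformly_continuous[OF gi \<open>\<epsilon>/2 > 0\<close>]) blast
  obtain \<delta>2 where \<delta>2: "\<delta>2 > 0" "\<And>h'. \<lbrakk>h' \<in> \<H>; ac_dist h' g < \<delta>2\<rbrakk> \<Longrightarrow>
      (LINT x|M. \<bar>transfer h' (homeo_deriv M (?i g)) x - transfer g (homeo_deriv M (?i g)) x\<bar>) < \<epsilon>/2"
    by (rule transfer_strongly_continuous[OF g homeo_deriv_integrable[OF gi] \<open>\<epsilon>/2 > 0\<close>]) blast
  define \<delta> where "\<delta> = min \<delta>1 \<delta>2"
  have "\<delta> > 0" using \<delta>1(1) \<delta>2(1) by (simp add: \<delta>_def)
  moreover have "ac_dist (?i g') (?i g) < \<epsilon>"
    if g': "g' \<in> \<H>" and close: "ac_dist g' g < \<delta>" for g'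
  proof -
    have gi': "?i g' \<in> \<H>" by (rule homeo_bac_inv[OF g'])
    have "sup_dist (?i g') (?i g) S \<le> \<epsilon>/2"
    proof (rule sup_dist_le)
      fix y assume y: "y \<in> S"
      define x where "x = ?i g' y"
      have x: "x \<in> S" using homeo_bac_into[OF gi' y] by (simp add: x_def)
      have y_eq: "g' x = y" using homeo_inv_right[OF homeo_bac_homeo[OF g']] y by (simp add: x_def)
      have x_eq: "?i g (g x) = x" using homeo_inv_left[OF homeo_bac_homeo[OF g]] x by simp
      have "d (g x) (g' x) < \<delta>1"
        using homeo_bac_le_sup_dist[OF g' g x] sup_dist_le_ac_dist[of g' g] close
        by (simp add: \<delta>_def commute)
      then have "d (?i g (g x)) (?i g (g' x)) < \<epsilon>/2"
        by (rule \<delta>1(2)[OF homeo_bac_into[OF g x] homeo_bac_into[OF g' x]])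
      then show "d (?i g' y) (?i g y) \<le> \<epsilon>/2" by (simp add: x_eq y_eq flip: x_def)
    qed (use \<epsilon> in simp)
    moreover have "rho_ac M (?i g') (?i g) < \<epsilon>/2"
    proof -
      note [simp] = g gi g' gi' transfer_integrable
      \<comment> \<open>The isometry of \<open>g'\<close> turns the derivative of its inverse into the constant 1, which \<open>g\<close> produces in the same way.\<close>
      have "rho_ac M (?i g') (?i g) =
          (LINT x|M. \<bar>transfer g' (homeo_deriv M (?i g')) x - transfer g' (homeo_deriv M (?i g)) x\<bar>)"
        by (simp add: transfer_isometry rho_ac_def)
      also have "\<dots> = (LINT x|M. \<bar>transfer g' (homeo_deriv M (?i g)) x - transfer g (homeo_deriv M (?i g)) x\<bar>)"
      proof (rule integral_cong_AE)
        show "AE x in M. \<bar>transfer g' (homeo_deriv M (?i g')) x - transfer g' (homeo_deriv M (?i g)) x\<bar> =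
            \<bar>transfer g' (homeo_deriv M (?i g)) x - transfer g (homeo_deriv M (?i g)) x\<bar>"
          using homeo_deriv_compose_inv[OF g] homeo_deriv_compose_inv[OF g']
          by eventually_elim (simp add: abs_minus_commute)
      qed (auto intro!: borel_measurable_integrable)
      also have "\<dots> < \<epsilon>/2" using close by (intro \<delta>2(2) g') (simp add: \<delta>_def)
      finally show ?thesis .
    qed
    ultimately show ?thesis unfolding ac_dist_def by linarith
  qed
  ultimately show thesis by (rule that)
qed

section \<open>The generated topology is the metric topology\<close>

lemma topspace_compact_open_homeo: "topspace (compact_open_homeo mtopology) = homeo mtopology"
  unfolding compact_open_homeo_def topology_generated_by_topspace
proof (intro equalityI subsetI)
  fix g assume g: "g \<in> homeo mtopology"
  have "homeo mtopology = {g \<in> homeo mtopology. g ` {} \<subseteq> {}}" by simp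
  then have "homeo mtopology \<in> {{g \<in> homeo mtopology. g ` K \<subseteq> U} |K U. compactin mtopology K \<and> openin mtopology U}"
    by blast
  then show "g \<in> \<Union>{{g \<in> homeo mtopology. g ` K \<subseteq> U} |K U. compactin mtopology K \<and> openin mtopology U}"
    using g by blast
qed blast

text \<open>
  The image of a compact set has a uniform neighbourhood inside each open set that contains it.
\<close>

lemma openin_ac_compact_open_subbasis:
  assumes K: "compactin mtopology K" and U: "openin mtopology U"
  shows "openin ac.mtopology ({g \<in> homeo mtopology. g ` K \<subseteq> U} \<inter> \<H>)"
  unfolding ac.openin_mtopology
proof (intro conjI allI impI)
  fix g assume "g \<in> {g \<in> homeo mtopology. g ` K \<subseteq> U} \<inter> \<H>"
  then have g: "g \<in> \<H>" and gK: "g ` K \<subseteq> U" by auto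
  have "compactin mtopology (g ` K)"
    by (rule image_compactin[OF K homeo_bac_continuous_map[OF g]])
  from lebesgue_number[OF this, of "{U}"] gK U
  obtain \<epsilon> where \<epsilon>: "\<epsilon> > 0" "\<And>x. x \<in> g ` K \<Longrightarrow> mball x \<epsilon> \<subseteq> U" by auto
  have KS: "K \<subseteq> S" using compactin_subset_topspace[OF K] by simp
  have "ac.mball g \<epsilon> \<subseteq> {g \<in> homeo mtopology. g ` K \<subseteq> U} \<inter> \<H>"
  proof
    fix h assume "h \<in> ac.mball g \<epsilon>"
    then have h: "h \<in> \<H>" and gh: "ac_dist g h < \<epsilon>" by auto
    have "h x \<in> U" if x: "x \<in> K" for x
    proof -
      have xS: "x \<in> S" using KS x by blast
      have "h x \<in> mball (g x) \<epsilon>"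
        using homeo_bac_le_sup_dist[OF g h xS] sup_dist_le_ac_dist[of g h] gh
          homeo_bac_into[OF g xS] homeo_bac_into[OF h xS] by auto
      then show ?thesis using \<epsilon>(2)[of "g x"] x by blast
    qed
    then show "h \<in> {g \<in> homeo mtopology. g ` K \<subseteq> U} \<inter> \<H>"
      using h homeo_bac_homeo[OF h] by blast
  qed
  then show "\<exists>r>0. ac.mball g r \<subseteq> {g \<in> homeo mtopology. g ` K \<subseteq> U} \<inter> \<H>"
    using \<epsilon>(1) by blast
qed blast

lemma openin_ac_rho_ball:
  assumes g: "g \<in> \<H>"
  shows "openin ac.mtopology {h \<in> \<H>. rho_ac M g h < r}"
  unfolding ac.openin_mtopology
proof (intro conjI allI impI)
  fix h assume "h \<in> {h \<in> \<H>. rho_ac M g h < r}"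
  then have h: "h \<in> \<H>" "rho_ac M g h < r" by auto
  have "ac.mball h (r - rho_ac M g h) \<subseteq> {h \<in> \<H>. rho_ac M g h < r}"
  proof
    fix k assume "k \<in> ac.mball h (r - rho_ac M g h)"
    then have k: "k \<in> \<H>" "ac_dist h k < r - rho_ac M g h" by auto
    then show "k \<in> {h \<in> \<H>. rho_ac M g h < r}"
      using rho_ac_triangle[OF g h(1) k(1)] rho_ac_le_ac_dist[of h k] by simp
  qed
  then show "\<exists>s>0. ac.mball h s \<subseteq> {h \<in> \<H>. rho_ac M g h < r}"
    using h(2) by (intro exI[of _ "r - rho_ac M g h"]) simp
qed blast

lemma openin_tau_ac_neighbourhood:
  assumes g: "g \<in> \<H>" and \<epsilon>: "\<epsilon> > 0"
  obtains W where "openin (tau_ac mtopology M) W" "g \<in> W" "W \<subseteq> ac.mball g \<epsilon>"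
proof -
  have "\<epsilon>/8 > 0" using \<epsilon> by simp
  obtain E where E: "finite E" "E \<subseteq> S" "\<And>x. x \<in> S \<Longrightarrow> \<exists>y\<in>E. d x y < \<epsilon>/8"
    by (rule compact_finite_net[OF compact \<open>\<epsilon>/8 > 0\<close>]) blast
  \<comment> \<open>The compact sets \<open>K y\<close> cover \<open>S\<close>, and each is mapped by \<open>g\<close>, with room to spare, into a small ball.\<close>
  define K where "K y = {x \<in> S. g x \<in> mcball y (\<epsilon>/8)}" for y
  define P where "P y = {h \<in> homeo mtopology. h ` K y \<subseteq> mball y (\<epsilon>/4)}" for y
  define W1 where "W1 = ((\<Inter>y\<in>E. P y) \<inter> topspace (compact_open_homeo mtopology)) \<inter> \<H>"
  define W2 where "W2 = {h \<in> \<H>. rho_ac M g h < \<epsilon>/4}"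
  have "openin (compact_open_homeo mtopology) (P y)" for y
  proof -
    have "closedin mtopology (K y)"
      using closedin_continuous_map_preimage[OF homeo_bac_continuous_map[OF g] closedin_mcball, of y "\<epsilon>/8"]
      by (simp add: K_def)
    then have "compactin mtopology (K y)" by (rule closedin_compact_space[OF compact])
    then show ?thesis unfolding compact_open_homeo_def P_def
      by (intro topology_generated_by_Basis) (use openin_mball in blast)
  qed
  then have "openin (compact_open_homeo mtopology) ((\<Inter>y\<in>E. P y) \<inter> topspace (compact_open_homeo mtopology))"
    by (intro openin_INT E)
  then have "openin (subtopology (compact_open_homeo mtopology) \<H>) W1"
    unfolding W1_def openin_subtopology by blast
  then have W1: "openin (tau_ac mtopology M) W1"
    unfolding tau_ac_def by (intro topology_generated_by_Basis) blast
  have "openin (pseudometric_topology \<H> (rho_ac M)) W2"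
    unfolding pseudometric_topology_def W2_def
    by (intro topology_generated_by_Basis CollectI exI[of _ g] exI[of _ "\<epsilon>/4"] conjI refl)
      (use g \<epsilon> in simp_all)
  then have W2: "openin (tau_ac mtopology M) W2"
    unfolding tau_ac_def by (intro topology_generated_by_Basis) blast
  have "g ` K y \<subseteq> mball y (\<epsilon>/4)" for y
    using \<epsilon> by (auto simp: K_def)
  then have "g \<in> W1"
    using g homeo_bac_homeo[OF g] by (auto simp: W1_def P_def topspace_compact_open_homeo)
  moreover have "g \<in> W2" using g \<epsilon> by (simp add: W2_def rho_ac_def)
  moreover have "W1 \<inter> W2 \<subseteq> ac.mball g \<epsilon>"
  proof
    fix h assume h12: "h \<in> W1 \<inter> W2"
    then have h: "h \<in> \<H>" and rho: "rho_ac M g h < \<epsilon>/4" by (auto simp: W2_def)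
    have "sup_dist g h S \<le> \<epsilon>/8 + \<epsilon>/4"
    proof (rule sup_dist_le)
      fix x assume x: "x \<in> S"
      have gx: "g x \<in> S" and hx: "h x \<in> S" using homeo_bac_into g h x by auto
      obtain y where y: "y \<in> E" "d (g x) y < \<epsilon>/8" using E(3)[OF gx] by blast
      have yS: "y \<in> S" using E(2) y(1) by blast
      have "x \<in> K y" using x y(2) yS gx by (simp add: K_def commute)
      moreover have "h \<in> P y" using h12 y(1) by (simp add: W1_def)
      ultimately have "h x \<in> mball y (\<epsilon>/4)" unfolding P_def by blast
      then have "d y (h x) < \<epsilon>/4" by simp
      then show "d (g x) (h x) \<le> \<epsilon>/8 + \<epsilon>/4"
        using triangle[OF gx yS hx] y(2) by linarith
    qed (use \<epsilon> in simp)
    then have "ac_dist g h < \<epsilon>" using rho \<epsilon> unfolding ac_dist_def by linarith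
    then show "h \<in> ac.mball g \<epsilon>" using g h by simp
  qed
  ultimately show thesis by (intro that[of "W1 \<inter> W2"] openin_Int W1 W2) auto
qed

lemma tau_ac_eq_mtopology: "tau_ac mtopology M = ac.mtopology"
proof (rule topology_eq[THEN iffD2], intro allI iffI)
  fix V assume "openin (tau_ac mtopology M) V"
  then have "generate_topology_on
     ({U. openin (subtopology (compact_open_homeo mtopology) \<H>) U} \<union>
      {U. openin (pseudometric_topology \<H> (rho_ac M)) U}) V"
    unfolding tau_ac_def by (rule openin_topology_generated_by)
  then show "openin ac.mtopology V"
  proof (induction rule: generate_topology_on.induct)
    case (Basis U)
    then consider "openin (subtopology (compact_open_homeo mtopology) \<H>) U"
      | "openin (pseudometric_topology \<H> (rho_ac M)) U" by blast
    then show ?case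
    proof cases
      case 1
      then obtain V where V: "openin (compact_open_homeo mtopology) V" "U = V \<inter> \<H>"
        unfolding openin_subtopology by blast
      from V(1) have "openin ac.mtopology (V \<inter> \<H>)"
        unfolding compact_open_homeo_def openin_topology_generated_by_iff
      proof (induction rule: generate_topology_on.induct)
        case (Int a b)
        have "a \<inter> b \<inter> \<H> = (a \<inter> \<H>) \<inter> (b \<inter> \<H>)" by blast
        then show ?case using openin_Int[OF Int.IH] by (simp only:)
      next
        case (UN K)
        have "\<Union>K \<inter> \<H> = (\<Union>k\<in>K. k \<inter> \<H>)" by blast
        moreover have "openin ac.mtopology (\<Union>k\<in>K. k \<inter> \<H>)"
          using UN.IH by (intro openin_Union) blast
        ultimately show ?case by (simp only:)
      next
        case (Basis s)
        then obtain K U where "compactin mtopology K" "openin mtopology U"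
            "s = {g \<in> homeo mtopology. g ` K \<subseteq> U}" by blast
        then show ?case using openin_ac_compact_open_subbasis by (simp only:)
      qed simp
      then show ?thesis using V(2) by (simp only:)
    next
      case 2
      then show ?thesis
        unfolding pseudometric_topology_def openin_topology_generated_by_iff
      proof (induction rule: generate_topology_on.induct)
        case (Basis s)
        then obtain g r where "g \<in> \<H>" "s = {h \<in> \<H>. rho_ac M g h < r}" by blast
        then show ?case using openin_ac_rho_ball by (simp only:)
      qed (auto intro: openin_Union)
    qed
  qed (auto intro: openin_Union)
next
  fix V assume V: "openin ac.mtopology V"
  show "openin (tau_ac mtopology M) V"
  proof (subst openin_subopen, intro ballI)
    fix g assume gV: "g \<in> V"
    then have g: "g \<in> \<H>" using openin_subset[OF V] by auto
    obtain \<epsilon> where \<epsilon>: "\<epsilon> > 0" "ac.mball g \<epsilon> \<subseteq> V"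
      using V gV unfolding ac.openin_mtopology by blast
    obtain W where "openin (tau_ac mtopology M) W" "g \<in> W" "W \<subseteq> ac.mball g \<epsilon>"
      by (rule openin_tau_ac_neighbourhood[OF g \<epsilon>(1)])
    then show "\<exists>W. openin (tau_ac mtopology M) W \<and> g \<in> W \<and> W \<subseteq> V" using \<epsilon>(2) by blast
  qed
qed

lemma group_topology_tau_ac: "group_topology (homeo_bac_group mtopology M) (tau_ac mtopology M)"
  unfolding group_topology_def tau_ac_eq_mtopology
proof (intro conjI)
  show "group (homeo_bac_group mtopology M)" by (rule homeo_bac_group)
  show "topspace ac.mtopology = carrier (homeo_bac_group mtopology M)"
    by (simp add: homeo_bac_group)
  show "continuous_map (prod_topology ac.mtopology ac.mtopology) ac.mtopology
      (\<lambda>(g, h). g \<otimes>\<^bsub>homeo_bac_group mtopology M\<^esub> h)"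
    unfolding ac.continuous_map_to_metric
  proof (intro ballI allI impI)
    fix p and \<epsilon> :: real
    assume "p \<in> topspace (prod_topology ac.mtopology ac.mtopology)" and \<epsilon>: "\<epsilon> > 0"
    then obtain g h where p: "p = (g, h)" and g: "g \<in> \<H>" and h: "h \<in> \<H>" by auto
    obtain \<delta> where \<delta>: "\<delta> > 0" "\<And>g' h'. \<lbrakk>g' \<in> \<H>; h' \<in> \<H>; ac_dist g' g < \<delta>; ac_dist h' h < \<delta>\<rbrakk>
        \<Longrightarrow> ac_dist (compose S g' h') (compose S g h) < \<epsilon>"
      by (rule ac_dist_compose_continuous[OF g h \<epsilon>]) blast
    have prod_close: "(case q of (g', h') \<Rightarrow> g' \<otimes>\<^bsub>homeo_bac_group mtopology M\<^esub> h')
        \<in> ac.mball (g \<otimes>\<^bsub>homeo_bac_group mtopology M\<^esub> h) \<epsilon>"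
      if "q \<in> ac.mball g \<delta> \<times> ac.mball h \<delta>" for q
    proof -
      obtain g' h' where "q = (g', h')" by (cases q)
      with that have q': "q = (g', h')" "g' \<in> \<H>" "h' \<in> \<H>" "ac_dist g' g < \<delta>" "ac_dist h' h < \<delta>"
        by (auto simp: ac.commute)
      then show ?thesis
        using \<delta>(2)[OF q'(2-5)] g h homeo_bac_compose[OF g h] homeo_bac_compose[OF q'(2,3)]
        by (simp add: homeo_bac_group ac.commute)
    qed
    have prod_open: "openin (prod_topology ac.mtopology ac.mtopology) (ac.mball g \<delta> \<times> ac.mball h \<delta>)"
      by (simp add: openin_prod_Times_iff)
    have prod_mem: "(g, h) \<in> ac.mball g \<delta> \<times> ac.mball h \<delta>" using g h \<delta>(1) by simp
    show "\<exists>U. openin (prod_topology ac.mtopology ac.mtopology) U \<and> p \<in> U \<and>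
        (\<forall>q\<in>U. (case q of (g', h') \<Rightarrow> g' \<otimes>\<^bsub>homeo_bac_group mtopology M\<^esub> h')
          \<in> ac.mball (case p of (g, h) \<Rightarrow> g \<otimes>\<^bsub>homeo_bac_group mtopology M\<^esub> h) \<epsilon>)"
      unfolding p prod.case[of _ g h]
      by (rule exI[of _ "ac.mball g \<delta> \<times> ac.mball h \<delta>"], intro conjI ballI prod_open prod_mem)
        (rule prod_close)
  qed
  show "continuous_map ac.mtopology ac.mtopology (\<lambda>g. inv\<^bsub>homeo_bac_group mtopology M\<^esub> g)"
    unfolding ac.continuous_map_to_metric
  proof (intro ballI allI impI)
    fix g and \<epsilon> :: real
    assume "g \<in> topspace ac.mtopology" and \<epsilon>: "\<epsilon> > 0"
    then have g: "g \<in> \<H>" by simp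
    obtain \<delta> where \<delta>: "\<delta> > 0" "\<And>g'. \<lbrakk>g' \<in> \<H>; ac_dist g' g < \<delta>\<rbrakk>
        \<Longrightarrow> ac_dist (homeo_inv mtopology g') (homeo_inv mtopology g) < \<epsilon>"
      by (rule ac_dist_inv_continuous[OF g \<epsilon>]) blast
    have "inv\<^bsub>homeo_bac_group mtopology M\<^esub> g' \<in> ac.mball (inv\<^bsub>homeo_bac_group mtopology M\<^esub> g) \<epsilon>"
      if "g' \<in> ac.mball g \<delta>" for g'
      using that \<delta>(2)[of g'] g homeo_bac_inv[of g] homeo_bac_inv[of g']
      by (simp add: homeo_bac_group ac.commute)
    then show "\<exists>U. openin ac.mtopology U \<and> g \<in> U \<and>
        (\<forall>g'\<in>U. inv\<^bsub>homeo_bac_group mtopology M\<^esub> g' \<in> ac.mball (inv\<^bsub>homeo_bac_group mtopology M\<^esub> g) \<epsilon>)"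
      using g \<delta>(1) by (intro exI[of _ "ac.mball g \<delta>"]) simp
  qed
qed

section \<open>Completeness\<close>

text \<open>
  Uniform limits of mutually inverse maps are mutually inverse, because the limit is uniformly
  continuous. This is why a complete metric must control the inverses: a uniform limit of
  homeomorphisms alone need not be injective.
\<close>

lemma compact_continuous_limits_inverse:
  assumes g: "continuous_map mtopology mtopology g"
    and s: "\<And>n x. x \<in> S \<Longrightarrow> s n x \<in> S" and t: "\<And>n x. x \<in> S \<Longrightarrow> t n x \<in> S"
    and inv: "\<And>n x. x \<in> S \<Longrightarrow> s n (t n x) = x"
    and sg: "\<And>\<epsilon>. 0 < \<epsilon> \<Longrightarrow> \<forall>\<^sub>F n in sequentially. \<forall>x\<in>S. d (s n x) (g x) < \<epsilon>"
    and tu: "\<And>\<epsilon>. 0 < \<epsilon> \<Longrightarrow> \<forall>\<^sub>F n in sequentially. \<forall>x\<in>S. d (t n x) (u x) < \<epsilon>"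
    and x: "x \<in> S" and ux: "u x \<in> S"
  shows "g (u x) = x"
proof -
  have gS: "g y \<in> S" if "y \<in> S" for y
    using g that continuous_map_image_subset_topspace[OF g] by auto
  have "d (g (u x)) x \<le> 0 + \<epsilon>" if \<epsilon>: "\<epsilon> > 0" for \<epsilon>
  proof -
    have "\<epsilon>/2 > 0" using \<epsilon> by simp
    obtain \<delta> where \<delta>: "\<delta> > 0" "\<And>x y. \<lbrakk>x \<in> S; y \<in> S; d x y < \<delta>\<rbrakk> \<Longrightarrow> d (g x) (g y) < \<epsilon>/2"
      by (rule compact_uniformly_continuous[OF compact Metric_space_axioms g \<open>\<epsilon>/2 > 0\<close>]) blast
    have "\<forall>\<^sub>F n in sequentially. (\<forall>x\<in>S. d (s n x) (g x) < \<epsilon>/2) \<and> (\<forall>x\<in>S. d (t n x) (u x) < \<delta>)"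
      using sg[OF \<open>\<epsilon>/2 > 0\<close>] tu[OF \<delta>(1)] by eventually_elim blast
    then obtain n where n: "\<forall>x\<in>S. d (s n x) (g x) < \<epsilon>/2" "\<forall>x\<in>S. d (t n x) (u x) < \<delta>"
      by (auto simp: eventually_sequentially)
    have "d (g (u x)) (g (t n x)) < \<epsilon>/2"
      using n(2) x by (intro \<delta>(2) ux t) (simp_all add: commute)
    moreover have "d (g (t n x)) (s n (t n x)) < \<epsilon>/2"
      using bspec[OF n(1) t[OF x, of n]] by (simp add: commute)
    moreover have "d (g (u x)) (s n (t n x)) \<le> d (g (u x)) (g (t n x)) + d (g (t n x)) (s n (t n x))"
      by (rule triangle) (use gS ux t[OF x] s in auto)
    ultimately show ?thesis using inv[OF x] by simp
  qed
  then have "d (g (u x)) x \<le> 0" by (rule field_le_epsilon)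
  then show ?thesis using zero[OF gS[OF ux] x] nonneg[of "g (u x)" x] by linarith
qed

text \<open>
  Pullback measures converge weakly when the inverse maps converge pointwise, and in total variation
  when the derivatives converge in \<open>L\<^sup>1\<close>. The two limits agree on continuous functions and are
  therefore the same measure.
\<close>

lemma pullback_measure_limit:
  assumes \<sigma>: "\<And>n. \<sigma> n \<in> \<H>" and g: "g \<in> homeo mtopology"
    and conv: "\<And>x. x \<in> S \<Longrightarrow>
      limitin mtopology (\<lambda>n. homeo_inv mtopology (\<sigma> n) x) (homeo_inv mtopology g x) sequentially"
    and f: "integrable M f" "\<And>x. 0 \<le> f x"
    and L1: "(\<lambda>n. LINT x|M. \<bar>homeo_deriv M (\<sigma> n) x - f x\<bar>) \<longlonglongrightarrow> 0"
  shows "density M (\<lambda>x. ennreal (f x)) = pullback_measure M g"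
proof (rule finite_measure_eqI_continuous[OF metrizable_space_mtopology])
  let ?i = "homeo_inv mtopology"
  have [measurable]: "f \<in> borel_measurable M" using f(1) by simp
  show "finite_measure (density M (\<lambda>x. ennreal (f x)))"
  proof (rule finite_measureI)
    have "emeasure (density M (\<lambda>x. ennreal (f x))) (space M) = (\<integral>\<^sup>+x. ennreal (f x) \<partial>M)"
      by (simp add: emeasure_density cong: nn_integral_cong)
    also have "\<dots> = ennreal (integral\<^sup>L M f)"
      using f by (intro nn_integral_eq_integral) auto
    finally show "emeasure (density M (\<lambda>x. ennreal (f x))) (space (density M (\<lambda>x. ennreal (f x)))) \<noteq> \<infinity>"
      by simp
  qed
  show "finite_measure (pullback_measure M g)" by (rule finite_pullback_measure[OF g])
  show "sets (density M (\<lambda>x. ennreal (f x))) = sets (borel_of mtopology)"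
    "sets (pullback_measure M g) = sets (borel_of mtopology)"
    by (simp_all add: sets_M)
  fix \<phi> :: "'a \<Rightarrow> real"
  assume \<phi>: "continuous_map mtopology euclidean \<phi>"
    and bnd: "\<And>x. x \<in> topspace mtopology \<Longrightarrow> 0 \<le> \<phi> x \<and> \<phi> x \<le> 1"
  have bnd: "\<bar>\<phi> x\<bar> \<le> 1" if "x \<in> S" for x using bnd[of x] that by auto
  have [measurable]: "\<phi> \<in> borel_measurable M"
    using continuous_map_borel_measurable[OF \<phi>] by (simp cong: measurable_cong_sets add: measurable_cong_sets[OF sets_M refl])
  have i_meas [measurable]: "?i h \<in> measurable M M" if "h \<in> homeo mtopology" for h
    by (rule homeo_measurable[OF homeo_inv_homeo[OF that]])
  have \<sigma>h: "\<sigma> n \<in> homeo mtopology" for n by (rule homeo_bac_homeo[OF \<sigma>])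
  have pull: "integral\<^sup>L (pullback_measure M h) \<phi> = (LINT x|M. \<phi> (?i h x))" if "h \<in> homeo mtopology" for h
    unfolding pullback_measure_eq_distr using that by (intro integral_distr i_meas) measurable
  \<comment> \<open>The integral of \<open>\<phi>\<close> against the pullback under \<open>\<sigma> n\<close> is evaluated in two ways: by transport, then by density.\<close>
  have lim1: "(\<lambda>n. LINT x|M. \<phi> (?i (\<sigma> n) x)) \<longlonglongrightarrow> (LINT x|M. \<phi> (?i g x))"
  proof (rule integral_dominated_convergence[where w = "\<lambda>_. 1"])
    show "(\<lambda>x. \<phi> (?i g x)) \<in> borel_measurable M"
      by (rule measurable_compose[OF i_meas[OF g]]) measurable
    show "(\<lambda>x. \<phi> (?i (\<sigma> n) x)) \<in> borel_measurable M" for n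
      by (rule measurable_compose[OF i_meas[OF \<sigma>h]]) measurable
    show "AE x in M. (\<lambda>n. \<phi> (?i (\<sigma> n) x)) \<longlonglongrightarrow> \<phi> (?i g x)"
    proof (rule AE_I2)
      fix x assume "x \<in> space M"
      then have "limitin euclidean (\<lambda>n. \<phi> (?i (\<sigma> n) x)) (\<phi> (?i g x)) sequentially"
        using continuous_map_limit[OF \<phi> conv[of x]] by (simp add: space_M o_def)
      then show "(\<lambda>n. \<phi> (?i (\<sigma> n) x)) \<longlonglongrightarrow> \<phi> (?i g x)" by simp
    qed
    show "AE x in M. norm (\<phi> (?i (\<sigma> n) x)) \<le> 1" for n
      using bnd homeo_into[OF homeo_inv_homeo[OF \<sigma>h]] by (intro AE_I2) (simp add: space_M)
  qed simp
  have \<phi>u: "integrable M (\<lambda>x. u x * \<phi> x)" if u: "integrable M u" for u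
  proof (rule Bochner_Integration.integrable_bound[OF u])
    have "u \<in> borel_measurable M" using u by simp
    then show "(\<lambda>x. u x * \<phi> x) \<in> borel_measurable M" by measurable
    show "AE x in M. norm (u x * \<phi> x) \<le> norm (u x)"
      using bnd by (intro AE_I2) (simp add: space_M abs_mult mult_left_le)
  qed
  have "(\<lambda>n. (LINT x|M. homeo_deriv M (\<sigma> n) x * \<phi> x) - (LINT x|M. f x * \<phi> x)) \<longlonglongrightarrow> 0"
  proof (rule Lim_null_comparison[OF always_eventually[OF allI] L1])
    fix n
    have int: "integrable M (homeo_deriv M (\<sigma> n))" using \<sigma> by simp
    have "(LINT x|M. homeo_deriv M (\<sigma> n) x * \<phi> x) - (LINT x|M. f x * \<phi> x) =
        (LINT x|M. (homeo_deriv M (\<sigma> n) x - f x) * \<phi> x)"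
      using \<phi>u[OF int] \<phi>u[OF f(1)] by (simp add: left_diff_distrib)
    also have "norm \<dots> \<le> (LINT x|M. norm ((homeo_deriv M (\<sigma> n) x - f x) * \<phi> x))"
      by (rule integral_norm_bound)
    also have "\<dots> \<le> (LINT x|M. \<bar>homeo_deriv M (\<sigma> n) x - f x\<bar>)"
    proof (rule integral_mono)
      show "integrable M (\<lambda>x. norm ((homeo_deriv M (\<sigma> n) x - f x) * \<phi> x))"
        by (rule integrable_norm[OF \<phi>u[OF Bochner_Integration.integrable_diff[OF int f(1)]]])
      show "norm ((homeo_deriv M (\<sigma> n) x - f x) * \<phi> x) \<le> \<bar>homeo_deriv M (\<sigma> n) x - f x\<bar>"
        if "x \<in> space M" for x
        using bnd[of x] that by (simp add: space_M abs_mult mult_left_le)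
    qed (use int f in simp)
    finally show "norm ((LINT x|M. homeo_deriv M (\<sigma> n) x * \<phi> x) - (LINT x|M. f x * \<phi> x))
        \<le> (LINT x|M. \<bar>homeo_deriv M (\<sigma> n) x - f x\<bar>)" .
  qed
  then have "(\<lambda>n. LINT x|M. homeo_deriv M (\<sigma> n) x * \<phi> x) \<longlonglongrightarrow> (LINT x|M. f x * \<phi> x)"
    by (simp add: LIM_zero_iff)
  moreover have "(LINT x|M. homeo_deriv M (\<sigma> n) x * \<phi> x) = (LINT x|M. \<phi> (?i (\<sigma> n) x))" for n
    unfolding pull[OF \<sigma>h, symmetric] density_homeo_deriv[OF \<sigma>, symmetric]
    by (subst integral_density) auto
  moreover have "integral\<^sup>L (density M (\<lambda>x. ennreal (f x))) \<phi> = (LINT x|M. f x * \<phi> x)"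
    by (subst integral_density) (use f(2) in auto)
  ultimately show "integral\<^sup>L (density M (\<lambda>x. ennreal (f x))) \<phi> = integral\<^sup>L (pullback_measure M g) \<phi>"
    using LIMSEQ_unique[OF lim1] by (simp add: pull[OF g])
qed

lemma ac_Cauchy_L1_limit:
  assumes \<sigma>: "ac.MCauchy \<sigma>"
  obtains f where "integrable M f" "\<And>x. 0 \<le> f x"
    "(\<lambda>n. LINT x|M. \<bar>homeo_deriv M (\<sigma> n) x - f x\<bar>) \<longlonglongrightarrow> 0"
proof -
  have \<sigma>H: "\<sigma> n \<in> \<H>" for n using \<sigma> unfolding ac.MCauchy_def by blast
  have \<sigma>int: "integrable M (homeo_deriv M (\<sigma> n))" for n using \<sigma>H by simp
  have Cauchy: "\<exists>K. \<forall>m\<ge>K. \<forall>n\<ge>K. (LINT x|M. \<bar>homeo_deriv M (\<sigma> m) x - homeo_deriv M (\<sigma> n) x\<bar>) < \<epsilon>"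
    if "\<epsilon> > 0" for \<epsilon>
  proof -
    have "\<exists>K. \<forall>m n. K \<le> m \<longrightarrow> K \<le> n \<longrightarrow> ac_dist (\<sigma> m) (\<sigma> n) < \<epsilon>"
      using \<sigma> that by (simp add: ac.MCauchy_def)
    then obtain K where "\<forall>m n. K \<le> m \<longrightarrow> K \<le> n \<longrightarrow> ac_dist (\<sigma> m) (\<sigma> n) < \<epsilon>" ..
    then show ?thesis
      unfolding rho_ac_def[symmetric]
      by (intro exI[of _ K] allI impI) (simp add: le_less_trans[OF rho_ac_le_ac_dist])
  qed
  obtain f where f: "integrable M f" "(\<lambda>n. LINT x|M. \<bar>homeo_deriv M (\<sigma> n) x - f x\<bar>) \<longlonglongrightarrow> 0"
    by (rule L1_complete[OF \<sigma>int Cauchy])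
  \<comment> \<open>The derivatives are nonnegative, so the limit may be replaced by its absolute value.\<close>
  have "(\<lambda>n. LINT x|M. \<bar>homeo_deriv M (\<sigma> n) x - \<bar>f x\<bar>\<bar>) \<longlonglongrightarrow> 0"
  proof (rule tendsto_sandwich[OF _ _ tendsto_const f(2)])
    show "\<forall>\<^sub>F n in sequentially. (LINT x|M. \<bar>homeo_deriv M (\<sigma> n) x - \<bar>f x\<bar>\<bar>)
        \<le> (LINT x|M. \<bar>homeo_deriv M (\<sigma> n) x - f x\<bar>)"
    proof (rule always_eventually, rule allI, rule integral_mono)
      show "\<bar>homeo_deriv M (\<sigma> n) x - \<bar>f x\<bar>\<bar> \<le> \<bar>homeo_deriv M (\<sigma> n) x - f x\<bar>" for n x
        using homeo_deriv_nonneg[of "\<sigma> n" x] by arith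
    qed (use \<sigma>int f(1) in auto)
  qed simp
  then show thesis using f(1) by (intro that[of "\<lambda>x. \<bar>f x\<bar>"]) auto
qed

lemma ac_dist_tendsto_zero:
  assumes \<sigma>: "\<And>n. \<sigma> n \<in> \<H>" and g: "g \<in> \<H>"
    and unif: "\<And>\<epsilon>. 0 < \<epsilon> \<Longrightarrow> \<forall>\<^sub>F n in sequentially. \<forall>x\<in>S. d (\<sigma> n x) (g x) < \<epsilon>"
    and f: "integrable M f" "\<And>x. 0 \<le> f x"
    and L1: "(\<lambda>n. LINT x|M. \<bar>homeo_deriv M (\<sigma> n) x - f x\<bar>) \<longlonglongrightarrow> 0"
    and pull: "density M (\<lambda>x. ennreal (f x)) = pullback_measure M g"
  shows "(\<lambda>n. ac_dist (\<sigma> n) g) \<longlonglongrightarrow> 0"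
proof -
  have "AE x in M. homeo_deriv M g x = f x"
    by (rule homeo_deriv_unique) (use f pull in auto)
  then have "rho_ac M (\<sigma> n) g = (LINT x|M. \<bar>homeo_deriv M (\<sigma> n) x - f x\<bar>)" for n
    unfolding rho_ac_def using f(1) by (intro integral_cong_AE) auto
  then have "(\<lambda>n. rho_ac M (\<sigma> n) g) \<longlonglongrightarrow> 0" using L1 by simp
  moreover have "(\<lambda>n. sup_dist (\<sigma> n) g S) \<longlonglongrightarrow> 0"
  proof (rule tendstoI)
    fix \<epsilon> :: real assume "\<epsilon> > 0"
    then have "\<epsilon>/2 > 0" by simp
    from unif[OF this] show "\<forall>\<^sub>F n in sequentially. dist (sup_dist (\<sigma> n) g S) 0 < \<epsilon>"
    proof eventually_elim
      case (elim n)
      then have "sup_dist (\<sigma> n) g S \<le> \<epsilon>/2"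
        using \<open>\<epsilon> > 0\<close> by (intro sup_dist_le) (auto intro: less_imp_le)
      then show ?case using \<open>\<epsilon> > 0\<close> sup_dist_nonneg[of "\<sigma> n" g S] by simp
    qed
  qed
  ultimately show ?thesis unfolding ac_dist_def using tendsto_add by fastforce
qed

text \<open>
  The metric \<^const>\<open>ac_dist\<close> is in general not complete; adding the distance of the inverses repairs
  this without changing the topology, since inversion is continuous.
\<close>

definition ac_full_dist :: "('a \<Rightarrow> 'a) \<Rightarrow> ('a \<Rightarrow> 'a) \<Rightarrow> real" where
  "ac_full_dist g h = ac_dist g h + ac_dist (homeo_inv mtopology g) (homeo_inv mtopology h)"

sublocale full: Metric_space \<H> ac_full_dist
proof
  show "0 \<le> ac_full_dist g h" for g h by (simp add: ac_full_dist_def)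
  show "ac_full_dist g h = ac_full_dist h g" for g h
    by (simp add: ac_full_dist_def ac.commute)
  show "ac_full_dist g k \<le> ac_full_dist g h + ac_full_dist h k"
    if "g \<in> \<H>" "h \<in> \<H>" "k \<in> \<H>" for g h k
    unfolding ac_full_dist_def
    using ac.triangle[OF that] ac.triangle[OF that[THEN homeo_bac_inv]] by linarith
  show "ac_full_dist g h = 0 \<longleftrightarrow> g = h" if g: "g \<in> \<H>" and h: "h \<in> \<H>" for g h
  proof
    assume "ac_full_dist g h = 0"
    then have "ac_dist g h = 0"
      using ac.nonneg[of g h] ac.nonneg[of "homeo_inv mtopology g" "homeo_inv mtopology h"]
      unfolding ac_full_dist_def by linarith
    then show "g = h" using ac.zero[OF g h] by blast
  next
    assume "g = h"
    then show "ac_full_dist g h = 0"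
      using h homeo_bac_inv[OF h] by (simp add: ac_full_dist_def)
  qed
qed

lemma mtopology_full_eq: "full.mtopology = ac.mtopology"
proof (rule topology_eq[THEN iffD2], intro allI iffI)
  fix V assume V: "openin full.mtopology V"
  show "openin ac.mtopology V"
    unfolding ac.openin_mtopology
  proof (intro conjI allI impI)
    show sub: "V \<subseteq> \<H>" using openin_subset[OF V] by simp
    fix g assume gV: "g \<in> V"
    then have g: "g \<in> \<H>" using sub by blast
    obtain \<epsilon> where \<epsilon>: "\<epsilon> > 0" "full.mball g \<epsilon> \<subseteq> V"
      using V gV unfolding full.openin_mtopology by blast
    have "\<epsilon>/2 > 0" using \<epsilon> by simp
    obtain \<delta> where \<delta>: "\<delta> > 0" "\<And>g'. \<lbrakk>g' \<in> \<H>; ac_dist g' g < \<delta>\<rbrakk>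
        \<Longrightarrow> ac_dist (homeo_inv mtopology g') (homeo_inv mtopology g) < \<epsilon>/2"
      by (rule ac_dist_inv_continuous[OF g \<open>\<epsilon>/2 > 0\<close>]) blast
    have "ac.mball g (min (\<epsilon>/2) \<delta>) \<subseteq> full.mball g \<epsilon>"
    proof
      fix h assume "h \<in> ac.mball g (min (\<epsilon>/2) \<delta>)"
      then have h: "h \<in> \<H>" "ac_dist h g < \<epsilon>/2" "ac_dist h g < \<delta>" by (auto simp: ac.commute)
      then have "ac_full_dist h g < \<epsilon>" using \<delta>(2)[of h] by (simp add: ac_full_dist_def)
      then show "h \<in> full.mball g \<epsilon>" using g h by (simp add: full.commute)
    qed
    then show "\<exists>r>0. ac.mball g r \<subseteq> V"
      using \<epsilon> \<delta>(1) by (intro exI[of _ "min (\<epsilon>/2) \<delta>"]) auto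
  qed
next
  fix V assume V: "openin ac.mtopology V"
  show "openin full.mtopology V"
    unfolding full.openin_mtopology
  proof (intro conjI allI impI)
    show sub: "V \<subseteq> \<H>" using openin_subset[OF V] by simp
    fix g assume "g \<in> V"
    then obtain \<epsilon> where \<epsilon>: "\<epsilon> > 0" "ac.mball g \<epsilon> \<subseteq> V"
      using V unfolding ac.openin_mtopology by blast
    have "full.mball g \<epsilon> \<subseteq> ac.mball g \<epsilon>"
    proof
      fix h assume "h \<in> full.mball g \<epsilon>"
      then show "h \<in> ac.mball g \<epsilon>"
        using ac.nonneg[of "homeo_inv mtopology g" "homeo_inv mtopology h"]
        by (auto simp: ac_full_dist_def simp del: ac.nonneg)
    qed
    then show "\<exists>r>0. full.mball g r \<subseteq> V" using \<epsilon> by blast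
  qed
qed

lemma ac_Cauchy_uniform_limit:
  assumes \<sigma>: "ac.MCauchy \<sigma>"
  obtains g where "continuous_map mtopology mtopology g"
    "\<And>\<epsilon>. 0 < \<epsilon> \<Longrightarrow> \<forall>\<^sub>F n in sequentially. \<forall>x\<in>S. d (\<sigma> n x) (g x) < \<epsilon>"
proof -
  have \<sigma>H: "\<sigma> n \<in> \<H>" for n using \<sigma> unfolding ac.MCauchy_def by blast
  have Cauchy: "\<exists>K. \<forall>m n x. K \<le> m \<longrightarrow> K \<le> n \<longrightarrow> x \<in> topspace mtopology \<longrightarrow> d (\<sigma> m x) (\<sigma> n x) < \<epsilon>"
    if "\<epsilon> > 0" for \<epsilon>
  proof -
    have "\<exists>K. \<forall>m n. K \<le> m \<longrightarrow> K \<le> n \<longrightarrow> ac_dist (\<sigma> m) (\<sigma> n) < \<epsilon>"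
      using \<sigma> that by (simp add: ac.MCauchy_def)
    then obtain K where "\<forall>m n. K \<le> m \<longrightarrow> K \<le> n \<longrightarrow> ac_dist (\<sigma> m) (\<sigma> n) < \<epsilon>" ..
    then have K: "ac_dist (\<sigma> m) (\<sigma> n) < \<epsilon>" if "K \<le> m" "K \<le> n" for m n using that by simp
    have "d (\<sigma> m x) (\<sigma> n x) < \<epsilon>" if "K \<le> m" "K \<le> n" "x \<in> S" for m n x
      using K[OF that(1,2)] sup_dist_le_ac_dist[of "\<sigma> m" "\<sigma> n"]
        homeo_bac_le_sup_dist[OF \<sigma>H \<sigma>H that(3), of m n] by linarith
    then show ?thesis by auto
  qed
  show thesis
    by (rule continuous_map_uniformly_Cauchy_limit[OF compact_space_imp_mcomplete[OF compact] _ Cauchy])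
      (auto simp: homeo_bac_continuous_map[OF \<sigma>H] intro: that)
qed

lemma mcomplete_full: "full.mcomplete"
  unfolding full.mcomplete_def
proof (intro allI impI)
  let ?i = "homeo_inv mtopology"
  fix \<sigma> assume \<sigma>: "full.MCauchy \<sigma>"
  have \<sigma>H: "\<sigma> n \<in> \<H>" for n using \<sigma> unfolding full.MCauchy_def by blast
  have \<sigma>h: "\<sigma> n \<in> homeo mtopology" for n by (rule homeo_bac_homeo[OF \<sigma>H])
  define \<tau> where "\<tau> n = ?i (\<sigma> n)" for n
  have \<tau>H: "\<tau> n \<in> \<H>" for n unfolding \<tau>_def by (rule homeo_bac_inv[OF \<sigma>H])
  have Cauchy: "ac.MCauchy \<sigma>" "ac.MCauchy \<tau>"
  proof -
    have *: "ac_dist (\<sigma> m) (\<sigma> n) \<le> ac_full_dist (\<sigma> m) (\<sigma> n)"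
        "ac_dist (\<tau> m) (\<tau> n) \<le> ac_full_dist (\<sigma> m) (\<sigma> n)" for m n
      by (simp_all add: ac_full_dist_def \<tau>_def)
    have tail: "\<exists>K. \<forall>m n. K \<le> m \<longrightarrow> K \<le> n \<longrightarrow> ac_full_dist (\<sigma> m) (\<sigma> n) < \<epsilon>" if "\<epsilon> > 0" for \<epsilon>
      using \<sigma> that by (simp add: full.MCauchy_def)
    show "ac.MCauchy \<sigma>" unfolding ac.MCauchy_def
    proof (intro conjI allI impI image_subsetI \<sigma>H)
      fix \<epsilon> :: real assume "\<epsilon> > 0"
      from tail[OF this] show "\<exists>K. \<forall>m n. K \<le> m \<longrightarrow> K \<le> n \<longrightarrow> ac_dist (\<sigma> m) (\<sigma> n) < \<epsilon>"
        using le_less_trans[OF *(1)] by blast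
    qed
    show "ac.MCauchy \<tau>" unfolding ac.MCauchy_def
    proof (intro conjI allI impI image_subsetI \<tau>H)
      fix \<epsilon> :: real assume "\<epsilon> > 0"
      from tail[OF this] show "\<exists>K. \<forall>m n. K \<le> m \<longrightarrow> K \<le> n \<longrightarrow> ac_dist (\<tau> m) (\<tau> n) < \<epsilon>"
        using le_less_trans[OF *(2)] by blast
    qed
  qed
  obtain g0 where g0: "continuous_map mtopology mtopology g0"
    "\<And>\<epsilon>. 0 < \<epsilon> \<Longrightarrow> \<forall>\<^sub>F n in sequentially. \<forall>x\<in>S. d (\<sigma> n x) (g0 x) < \<epsilon>"
    by (rule ac_Cauchy_uniform_limit[OF Cauchy(1)]) blast
  obtain h0 where h0: "continuous_map mtopology mtopology h0"
    "\<And>\<epsilon>. 0 < \<epsilon> \<Longrightarrow> \<forall>\<^sub>F n in sequentially. \<forall>x\<in>S. d (\<tau> n x) (h0 x) < \<epsilon>"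
    by (rule ac_Cauchy_uniform_limit[OF Cauchy(2)]) blast
  have g0S: "g0 x \<in> S" and h0S: "h0 x \<in> S" if "x \<in> S" for x
    using that continuous_map_image_subset_topspace[OF g0(1)]
      continuous_map_image_subset_topspace[OF h0(1)] by auto
  have g0h0: "g0 (h0 x) = x" if x: "x \<in> S" for x
    by (rule compact_continuous_limits_inverse[OF g0(1) _ _ _ g0(2) h0(2) x h0S[OF x]])
      (simp_all add: homeo_bac_into[OF \<sigma>H] homeo_bac_into[OF \<tau>H] homeo_inv_right[OF \<sigma>h] \<tau>_def[symmetric],
        simp add: \<tau>_def homeo_inv_right[OF \<sigma>h])
  have h0g0: "h0 (g0 x) = x" if x: "x \<in> S" for x
    by (rule compact_continuous_limits_inverse[OF h0(1) _ _ _ h0(2) g0(2) x g0S[OF x]])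
      (simp_all add: homeo_bac_into[OF \<sigma>H] homeo_bac_into[OF \<tau>H],
        simp add: \<tau>_def homeo_inv_left[OF \<sigma>h])
  have "homeomorphic_map mtopology mtopology g0"
    using g0(1) h0(1) g0h0 h0g0
    by (auto simp: homeomorphic_map_maps homeomorphic_maps_def intro!: exI[of _ h0])
  then have "homeomorphic_map mtopology mtopology (restrict g0 S)"
    by (rule homeomorphic_map_eq) simp
  define g where "g = restrict g0 S"
  have gh: "g \<in> homeo mtopology"
    using \<open>homeomorphic_map mtopology mtopology (restrict g0 S)\<close> by (simp add: homeo_def g_def)
  have ig: "?i g x = h0 x" if x: "x \<in> S" for x
    using homeo_inv_left[OF gh, of "h0 x"] h0S[OF x] g0h0[OF x] by (simp add: g_def)
  have igh: "?i g \<in> homeo mtopology" by (rule homeo_inv_homeo[OF gh])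
  have \<sigma>g: "\<forall>\<^sub>F n in sequentially. \<forall>x\<in>S. d (\<sigma> n x) (g x) < \<epsilon>" if "\<epsilon> > 0" for \<epsilon>
    using g0(2)[OF that] by (simp add: g_def)
  have \<tau>g: "\<forall>\<^sub>F n in sequentially. \<forall>x\<in>S. d (\<tau> n x) (?i g x) < \<epsilon>" if "\<epsilon> > 0" for \<epsilon>
    using h0(2)[OF that] by (simp add: ig)
  have \<sigma>lim: "limitin mtopology (\<lambda>n. \<sigma> n x) (g x) sequentially" if x: "x \<in> S" for x
    unfolding limitin_metric
  proof (intro conjI allI impI)
    fix \<epsilon> :: real assume "\<epsilon> > 0"
    from \<sigma>g[OF this] show "\<forall>\<^sub>F n in sequentially. \<sigma> n x \<in> S \<and> d (\<sigma> n x) (g x) < \<epsilon>"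
      by eventually_elim (use x homeo_bac_into[OF \<sigma>H] in blast)
  qed (use x g0S in \<open>simp add: g_def\<close>)
  have \<tau>lim: "limitin mtopology (\<lambda>n. \<tau> n x) (?i g x) sequentially" if x: "x \<in> S" for x
    unfolding limitin_metric
  proof (intro conjI allI impI)
    fix \<epsilon> :: real assume "\<epsilon> > 0"
    from \<tau>g[OF this] show "\<forall>\<^sub>F n in sequentially. \<tau> n x \<in> S \<and> d (\<tau> n x) (?i g x) < \<epsilon>"
      by eventually_elim (use x homeo_bac_into[OF \<tau>H] in blast)
  qed (use x h0S ig in simp)
  obtain f where f: "integrable M f" "\<And>x. 0 \<le> f x"
    "(\<lambda>n. LINT x|M. \<bar>homeo_deriv M (\<sigma> n) x - f x\<bar>) \<longlonglongrightarrow> 0"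
    by (rule ac_Cauchy_L1_limit[OF Cauchy(1)]) blast
  obtain f' where f': "integrable M f'" "\<And>x. 0 \<le> f' x"
    "(\<lambda>n. LINT x|M. \<bar>homeo_deriv M (\<tau> n) x - f' x\<bar>) \<longlonglongrightarrow> 0"
    by (rule ac_Cauchy_L1_limit[OF Cauchy(2)]) blast
  have pull: "density M (\<lambda>x. ennreal (f x)) = pullback_measure M g"
    by (rule pullback_measure_limit[OF \<sigma>H gh _ f]) (use \<tau>lim in \<open>simp add: \<tau>_def\<close>)
  have "?i (\<tau> n) = \<sigma> n" for n by (simp add: \<tau>_def homeo_inv_inv[OF \<sigma>h])
  then have pull': "density M (\<lambda>x. ennreal (f' x)) = pullback_measure M (?i g)"
    by (intro pullback_measure_limit[OF \<tau>H igh _ f']) (use \<sigma>lim in \<open>simp add: homeo_inv_inv[OF gh]\<close>)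
  \<comment> \<open>A pullback measure with a density vanishes on null sets; applied to \<open>g\<close> and to its inverse, this gives both implications.\<close>
  have null: "emeasure M (k ` A) = 0"
    if "density M (\<lambda>x. ennreal (u x)) = pullback_measure M k" "k \<in> homeo mtopology"
      "integrable M u" "A \<in> sets M" "emeasure M A = 0" for u k A
  proof -
    have u: "(\<lambda>x. ennreal (u x)) \<in> borel_measurable M" using that(3) by simp
    have "A \<in> null_sets M" using that by (simp add: null_sets_def)
    then have "A \<in> null_sets (density M (\<lambda>x. ennreal (u x)))"
      using absolutely_continuousI_density[OF u] unfolding absolutely_continuous_def by blast
    then show ?thesis
      using that emeasure_pullback_measure[of k A] by (simp add: null_sets_def)
  qed
  have g: "g \<in> \<H>"
  proof (rule homeo_bacI[OF gh])
    fix A assume A: "A \<in> sets M"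
    have "?i g ` g ` A = A"
      by (rule inv_homeo_image_image[OF gh]) (use sets.sets_into_space[OF A] space_M in simp)
    then show "emeasure M (g ` A) = 0 \<longleftrightarrow> emeasure M A = 0"
      using null[OF pull gh f(1) A] null[OF pull' igh f'(1) homeo_image_sets[OF gh A]] by auto
  qed
  have "(\<lambda>n. ac_dist (\<sigma> n) g) \<longlonglongrightarrow> 0"
    by (rule ac_dist_tendsto_zero[OF \<sigma>H g \<sigma>g f pull])
  moreover have "(\<lambda>n. ac_dist (\<tau> n) (?i g)) \<longlonglongrightarrow> 0"
    by (rule ac_dist_tendsto_zero[OF \<tau>H homeo_bac_inv[OF g] \<tau>g f' pull'])
  ultimately have "(\<lambda>n. ac_dist (\<sigma> n) g + ac_dist (\<tau> n) (?i g)) \<longlonglongrightarrow> 0 + 0"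
    by (rule tendsto_add)
  then have "(\<lambda>n. ac_full_dist (\<sigma> n) g) \<longlonglongrightarrow> 0"
    by (simp add: ac_full_dist_def \<tau>_def)
  then show "\<exists>g. limitin full.mtopology \<sigma> g sequentially"
    unfolding full.limitin_metric_dist_null using g \<sigma>H by (intro exI[of _ g]) simp
qed

section \<open>Separability\<close>

text \<open>
  A homeomorphism is coded together with a continuous function that approximates its derivative in
  \<open>L\<^sup>1\<close>.
\<close>

lemma separable_ac: "separable_space ac.mtopology"
proof (rule ac.separable_if_countably_many_small_classes)
  fix \<epsilon> :: real assume \<epsilon>: "\<epsilon> > 0"
  define \<mu> where "\<mu> = measure M (space M)"
  have \<mu>: "\<mu> \<ge> 0" by (simp add: \<mu>_def)
  define \<eta> where "\<eta> = \<epsilon> / (16 * (\<mu> + 1))"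
  have \<eta>: "\<eta> > 0" using \<epsilon> \<mu> by (simp add: \<eta>_def)
  have "4 * \<eta> * \<mu> \<le> 4 * \<eta> * (\<mu> + 1)" using \<eta> by (intro mult_left_mono) auto
  also have "\<dots> = \<epsilon>/4" using \<mu> by (simp add: \<eta>_def field_simps add_nonneg_eq_0_iff)
  finally have \<eta>\<mu>: "4 * \<eta> * \<mu> \<le> \<epsilon>/4" .
  have "\<epsilon>/16 > 0" using \<epsilon> by simp
  obtain E where E: "finite E" "E \<subseteq> S" "\<And>x. x \<in> S \<Longrightarrow> \<exists>y\<in>E. d x y < \<epsilon>/16"
    by (rule compact_finite_net[OF compact \<open>\<epsilon>/16 > 0\<close>]) blast
  obtain c1 :: "('a \<Rightarrow> 'a) \<Rightarrow> nat \<times> ('a \<Rightarrow> 'a)" where c1: "countable (range c1)"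
    "\<And>f g x. \<lbrakk>continuous_map mtopology mtopology f; continuous_map mtopology mtopology g;
       c1 f = c1 g; x \<in> S\<rbrakk> \<Longrightarrow> d (f x) (g x) < 4 * (\<epsilon>/16)"
    by (rule continuous_maps_countably_many_small_classes[OF compact Metric_space_axioms
          countable_finite[OF E(1)] E(2,3) \<open>\<epsilon>/16 > 0\<close>]) blast+
  have rat: "\<exists>z\<in>\<rat>. dist y z < \<eta>" for y :: real
    using Rats_dense_in_real[of "y - \<eta>" y] \<eta> by (force simp: dist_real_def)
  obtain c2 :: "('a \<Rightarrow> real) \<Rightarrow> nat \<times> ('a \<Rightarrow> real)" where c2: "countable (range c2)"
    "\<And>f g x. \<lbrakk>continuous_map mtopology Met_TC.mtopology f; continuous_map mtopology Met_TC.mtopology g;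
       c2 f = c2 g; x \<in> S\<rbrakk> \<Longrightarrow> dist (f x) (g x) < 4 * \<eta>"
    by (rule continuous_maps_countably_many_small_classes[OF compact Met_TC.Metric_space_axioms
          countable_rat subset_UNIV rat \<eta>]) blast+
  have "\<exists>\<phi>. continuous_map mtopology euclidean \<phi> \<and> integrable M \<phi> \<and>
      (LINT x|M. \<bar>homeo_deriv M g x - \<phi> x\<bar>) < \<epsilon>/8" if "g \<in> \<H>" for g
    by (rule continuous_dense_L1[OF metrizable_space_mtopology finite_measure_axioms sets_M
          homeo_deriv_integrable[OF that], of "\<epsilon>/8"]) (use \<epsilon> in simp, blast)
  then obtain \<phi> where \<phi>: "\<And>g. g \<in> \<H> \<Longrightarrow> continuous_map mtopology euclidean (\<phi> g)"
    "\<And>g. g \<in> \<H> \<Longrightarrow> integrable M (\<phi> g)"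
    "\<And>g. g \<in> \<H> \<Longrightarrow> (LINT x|M. \<bar>homeo_deriv M g x - \<phi> g x\<bar>) < \<epsilon>/8"
    by metis
  define c where "c g = (c1 g, c2 (\<phi> g))" for g
  have "countable (c ` \<H>)"
    by (rule countable_subset[of _ "range c1 \<times> range c2"])
      (use c1(1) c2(1) in \<open>auto simp: c_def\<close>)
  moreover have "ac_dist g h < \<epsilon>" if g: "g \<in> \<H>" and h: "h \<in> \<H>" and eq: "c g = c h" for g h
  proof -
    have "sup_dist g h S \<le> \<epsilon>/4"
    proof (rule sup_dist_le)
      fix x assume "x \<in> S"
      from c1(2)[OF homeo_bac_continuous_map[OF g] homeo_bac_continuous_map[OF h] _ this] eq
      show "d (g x) (h x) \<le> \<epsilon>/4" by (simp add: c_def)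
    qed (use \<epsilon> in simp)
    moreover have "rho_ac M g h \<le> \<epsilon>/8 + \<epsilon>/4 + \<epsilon>/8"
    proof -
      note [simp] = g h \<phi>(2)[OF g] \<phi>(2)[OF h]
      have close: "\<bar>\<phi> g x - \<phi> h x\<bar> \<le> 4 * \<eta>" if "x \<in> space M" for x
        using c2(2)[of "\<phi> g" "\<phi> h" x] \<phi>(1)[OF g] \<phi>(1)[OF h] eq that
        by (simp add: c_def space_M dist_real_def)
      have "rho_ac M g h \<le> (LINT x|M. \<bar>homeo_deriv M g x - \<phi> g x\<bar> + 4 * \<eta> + \<bar>homeo_deriv M h x - \<phi> h x\<bar>)"
        unfolding rho_ac_def
      proof (rule integral_mono)
        fix x assume "x \<in> space M"
        from close[OF this] show "\<bar>homeo_deriv M g x - homeo_deriv M h x\<bar> \<le>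
            \<bar>homeo_deriv M g x - \<phi> g x\<bar> + 4 * \<eta> + \<bar>homeo_deriv M h x - \<phi> h x\<bar>" by linarith
      qed simp_all
      also have "\<dots> = (LINT x|M. \<bar>homeo_deriv M g x - \<phi> g x\<bar>) + 4 * \<eta> * \<mu> +
          (LINT x|M. \<bar>homeo_deriv M h x - \<phi> h x\<bar>)"
        by (simp add: \<mu>_def mult.commute)
      finally show ?thesis using \<phi>(3)[OF g] \<phi>(3)[OF h] \<eta>\<mu> by linarith
    qed
    ultimately show ?thesis unfolding ac_dist_def using \<epsilon> by linarith
  qed
  ultimately show "\<exists>c :: ('a \<Rightarrow> 'a) \<Rightarrow> (nat \<times> ('a \<Rightarrow> 'a)) \<times> (nat \<times> ('a \<Rightarrow> real)).
      countable (c ` \<H>) \<and> (\<forall>g\<in>\<H>. \<forall>h\<in>\<H>. c g = c h \<longrightarrow> ac_dist g h < \<epsilon>)"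
    by blast
qed

end

section \<open>Complete metrizability of the group topology\<close>

theorem proposition1:
  fixes X :: "'a topology" and M :: "'a measure"
  assumes "compact_space X" and "metrizable_space X"
    and "finite_measure M" and "sets M = sets (borel_of X)"
    and "\<exists>\<B>. (\<forall>V\<in>\<B>. openin X V \<and> emeasure M (X frontier_of V) = 0) \<and>
             (\<forall>U x. openin X U \<and> x \<in> U \<longrightarrow> (\<exists>V\<in>\<B>. x \<in> V \<and> V \<subseteq> U))"
  shows "group_topology (homeo_bac_group X M) (tau_ac X M) \<and>
         completely_metrizable_space (tau_ac X M) \<and>
         (separable_space X \<longrightarrow> polish_topology (tau_ac X M))"
proof -
  obtain S d where "Metric_space S d" and X: "X = Metric_space.mtopology S d"
    using assms(2) unfolding metrizable_space_def by blast
  then interpret Metric_space S d by simp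
  interpret compact_metric_measure S d M
    by (intro compact_metric_measure.intro compact_metric_measure_axioms.intro
        finite_borel_measure.intro finite_borel_measure_axioms.intro Metric_space_axioms)
      (use assms X in simp_all)
  have "completely_metrizable_space (tau_ac X M)"
    unfolding X tau_ac_eq_mtopology mtopology_full_eq[symmetric] completely_metrizable_space_def
    using full.Metric_space_axioms mcomplete_full by blast
  moreover have "separable_space (tau_ac X M)"
    unfolding X tau_ac_eq_mtopology by (rule separable_ac)
  ultimately show ?thesis
    using group_topology_tau_ac unfolding polish_topology_def X by blast
qed

end
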